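(* Let $\Bbbk$ be a field and let $\Bbbk^{\oplus n}=\Bbbk e_1\oplus\cdots\oplus\Bbbk e_n$ with the fixed pointwise multiplication, where $e_1,\dots,e_n$ are the primitive orthogonal idempotents. There is a bijective correspondence between weak bialgebra structures on $\Bbbk^{\oplus n}$ (with the fixed pointwise multiplication) and small categories $\mathcal C$ having exactly $m=\#\{i\mid\varepsilon(e_i)=1\}$ objects and $n$ morphisms, where the coproduct $\Delta$ gives the decomposition of a morphism into composite pairs. Conversely, given any finite category $\mathcal C$ with $n$ morphisms, its category algebra $\Bbbk\mathcal C$ inherits a weak bialgebra structure by taking the morphisms as a basis, defining multiplication by composition (or zero if not composable), defining the coproduct by $$\Delta(f)=\sum_{\substack{g,h:\\ g\circ h=f}} g\otimes h,$$ and defining the counit by $\varepsilon(f)=1$ if $f$ is an identity morphism and $\varepsilon(f)=0$ otherwise.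
   Context: $\Bbbk$ is an arbitrary base field. The pointwise multiplication on $\Bbbk^{\oplus n}$ is $e_ie_j=\delta_{ij}e_i$, with unit $1=e_1+\cdots+e_n$. A weak bialgebra over $\Bbbk$ is a vector space $B$ with an associative unital algebra structure and a coassociative counital coalgebra structure $(\Delta,\varepsilon)$ such that: (i) $\Delta(xy)=\Delta(x)\Delta(y)$ for all $x,y\in B$ (but $\Delta(1)=1\otimes1$ is not required); (ii) $(\Delta(1)\otimes1)(1\otimes\Delta(1))=(\Delta\otimes\mathrm{id})\Delta(1)=(1\otimes\Delta(1))(\Delta(1)\otimes1)$, and $\varepsilon(xyz)=\sum\varepsilon(xy_{(1)})\varepsilon(y_{(2)}z)=\sum\varepsilon(xy_{(2)})\varepsilon(y_{(1)}z)$ for all $x,y,z\in B$, where $\Delta(y)=\sum y_{(1)}\otimes y_{(2)}$. For every weak bialgebra structure on $\Bbbk^{\oplus n}$ with the pointwise multiplication, $\varepsilon(e_i)\in\{0,1\}$ for all $i$. In the correspondence, the morphisms of $\mathcal C$ are identified with the basis elements $e_1,\dots,e_n$, and the objects with the indices $i$ such that $\varepsilon(e_i)=1$, the identity morphism of such an object $i$ being $e_i$. In the coproduct formula the sum runs over pairs of composable morphisms $g,h$ of $\mathcal C$ with $g\circ h=f$.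
   Formalization: In the converse, multiplication by composition with the displayed Δ, ε fails (group of order two: Δ(1)Δ(1)=2Δ(1)); instead the displayed Δ, ε are paired with pointwise multiplication, and composition with the dual coproduct f↦f⊗f and counit f↦1. *)

theory Defs
  imports Main "HOL-Library.FuncSet"
begin

section \<open>Coordinate spaces and their tensor products\<close>

text \<open>
  The space with basis a finite set I is the set of functions vanishing off I.  Its tensor product
  with the space on J is the space on I \<open>\<times>\<close> J, with the pair (i, j) standing for the tensor
  product of the basis vectors i and j; tens is the product of two vectors.
  Triple tensor products are taken in the bracketing I \<open>\<times>\<close> (I \<open>\<times>\<close> I).
\<close>

definition vecs :: "'a set \<Rightarrow> ('a \<Rightarrow> 'k::field) set" where
  "vecs I = {v. \<forall>i. i \<notin> I \<longrightarrow> v i = 0}"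

definition basis_vec :: "'a \<Rightarrow> 'a \<Rightarrow> 'k::field" where
  "basis_vec i = (\<lambda>j. of_bool (j = i))"

definition tens :: "('a \<Rightarrow> 'k::field) \<Rightarrow> ('b \<Rightarrow> 'k) \<Rightarrow> ('a \<times> 'b \<Rightarrow> 'k)" where
  "tens u v = (\<lambda>(i, j). u i * v j)"

definition linear_map ::
    "'a set \<Rightarrow> 'b set \<Rightarrow> (('a \<Rightarrow> 'k::field) \<Rightarrow> ('b \<Rightarrow> 'k)) \<Rightarrow> bool" where
  "linear_map I J F \<longleftrightarrow>
     F \<in> vecs I \<rightarrow> vecs J \<and>
     (\<forall>u\<in>vecs I. \<forall>v\<in>vecs I. F (\<lambda>i. u i + v i) = (\<lambda>j. F u j + F v j)) \<and>
     (\<forall>c. \<forall>v\<in>vecs I. F (\<lambda>i. c * v i) = (\<lambda>j. c * F v j))"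

definition linear_form :: "'a set \<Rightarrow> (('a \<Rightarrow> 'k::field) \<Rightarrow> 'k) \<Rightarrow> bool" where
  "linear_form I \<phi> \<longleftrightarrow>
     (\<forall>u\<in>vecs I. \<forall>v\<in>vecs I. \<phi> (\<lambda>i. u i + v i) = \<phi> u + \<phi> v) \<and>
     (\<forall>c. \<forall>v\<in>vecs I. \<phi> (\<lambda>i. c * v i) = c * \<phi> v)"

definition bilinear_mult ::
    "'a set \<Rightarrow> (('a \<Rightarrow> 'k::field) \<Rightarrow> ('a \<Rightarrow> 'k) \<Rightarrow> ('a \<Rightarrow> 'k)) \<Rightarrow> bool" where
  "bilinear_mult I \<mu> \<longleftrightarrow>
     (\<forall>u\<in>vecs I. linear_map I I (\<lambda>v. \<mu> u v)) \<and>
     (\<forall>v\<in>vecs I. linear_map I I (\<lambda>u. \<mu> u v))"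

definition tensor_assoc :: "(('a \<times> 'b) \<times> 'c \<Rightarrow> 'k) \<Rightarrow> ('a \<times> ('b \<times> 'c) \<Rightarrow> 'k)" where
  "tensor_assoc t = (\<lambda>(i, (j, l)). t ((i, j), l))"

definition tensor_map ::
    "'a set \<Rightarrow> 'b set \<Rightarrow> (('a \<Rightarrow> 'k::field) \<Rightarrow> ('c \<Rightarrow> 'k)) \<Rightarrow> (('b \<Rightarrow> 'k) \<Rightarrow> ('d \<Rightarrow> 'k))
       \<Rightarrow> ('a \<times> 'b \<Rightarrow> 'k) \<Rightarrow> ('c \<times> 'd \<Rightarrow> 'k)" where
  "tensor_map I J F G t =
     (\<lambda>p. \<Sum>(i, j)\<in>I \<times> J. t (i, j) * tens (F (basis_vec i)) (G (basis_vec j)) p)"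

text \<open>
  Multiplication on the tensor product of two algebras: the bilinear extension of
  (a \<open>\<otimes>\<close> b)(a' \<open>\<otimes>\<close> b') = aa' \<open>\<otimes>\<close> bb'.
\<close>

definition tensor_mult ::
    "'a set \<Rightarrow> 'b set
       \<Rightarrow> (('a \<Rightarrow> 'k::field) \<Rightarrow> ('a \<Rightarrow> 'k) \<Rightarrow> ('a \<Rightarrow> 'k))
       \<Rightarrow> (('b \<Rightarrow> 'k) \<Rightarrow> ('b \<Rightarrow> 'k) \<Rightarrow> ('b \<Rightarrow> 'k))
       \<Rightarrow> ('a \<times> 'b \<Rightarrow> 'k) \<Rightarrow> ('a \<times> 'b \<Rightarrow> 'k) \<Rightarrow> ('a \<times> 'b \<Rightarrow> 'k)" where
  "tensor_mult I J \<mu> \<nu> s t =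
     (\<lambda>p. \<Sum>(a, b)\<in>I \<times> J. \<Sum>(a', b')\<in>I \<times> J. s (a, b) * t (a', b') *
            tens (\<mu> (basis_vec a) (basis_vec a')) (\<nu> (basis_vec b) (basis_vec b')) p)"


section \<open>Weak bialgebras\<close>

locale unital_algebra_on =
  fixes I :: "'a set"
    and mult :: "('a \<Rightarrow> 'k::field) \<Rightarrow> ('a \<Rightarrow> 'k) \<Rightarrow> ('a \<Rightarrow> 'k)"
    and unit :: "'a \<Rightarrow> 'k"
  assumes finite_basis: "finite I"
    and mult_bilinear: "bilinear_mult I mult"
    and unit_closed: "unit \<in> vecs I"
    and mult_assoc: "\<lbrakk>x \<in> vecs I; y \<in> vecs I; z \<in> vecs I\<rbrakk>
                       \<Longrightarrow> mult (mult x y) z = mult x (mult y z)"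
    and unit_left: "x \<in> vecs I \<Longrightarrow> mult unit x = x"
    and unit_right: "x \<in> vecs I \<Longrightarrow> mult x unit = x"

locale counital_coalgebra_on =
  fixes I :: "'a set"
    and \<Delta> :: "('a \<Rightarrow> 'k::field) \<Rightarrow> ('a \<times> 'a \<Rightarrow> 'k)"
    and \<epsilon> :: "('a \<Rightarrow> 'k) \<Rightarrow> 'k"
  assumes comult_linear: "linear_map I (I \<times> I) \<Delta>"
    and counit_linear: "linear_form I \<epsilon>"
    and comult_coassoc: "x \<in> vecs I \<Longrightarrow>
           tensor_assoc (tensor_map I I \<Delta> (\<lambda>v. v) (\<Delta> x)) = tensor_map I I (\<lambda>v. v) \<Delta> (\<Delta> x)"
    and counit_left: "x \<in> vecs I \<Longrightarrow>
           (\<lambda>p. \<Sum>(i, j)\<in>I \<times> I. \<Delta> x (i, j) * \<epsilon> (basis_vec i) * basis_vec j p) = x"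
    and counit_right: "x \<in> vecs I \<Longrightarrow>
           (\<lambda>p. \<Sum>(i, j)\<in>I \<times> I. \<Delta> x (i, j) * \<epsilon> (basis_vec j) * basis_vec i p) = x"

text \<open>
  In the last two axioms the Sweedler sum over y is the sum over the coordinates of \<open>\<Delta>\<close> y.
\<close>

locale weak_bialgebra_on =
  unital_algebra_on I mult unit + counital_coalgebra_on I \<Delta> \<epsilon>
  for I :: "'a set"
    and mult :: "('a \<Rightarrow> 'k::field) \<Rightarrow> ('a \<Rightarrow> 'k) \<Rightarrow> ('a \<Rightarrow> 'k)"
    and unit :: "'a \<Rightarrow> 'k"
    and \<Delta> :: "('a \<Rightarrow> 'k) \<Rightarrow> ('a \<times> 'a \<Rightarrow> 'k)"
    and \<epsilon> :: "('a \<Rightarrow> 'k) \<Rightarrow> 'k" +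
  assumes comult_mult: "\<lbrakk>x \<in> vecs I; y \<in> vecs I\<rbrakk> \<Longrightarrow>
           \<Delta> (mult x y) = tensor_mult I I mult mult (\<Delta> x) (\<Delta> y)"
    and weak_comult_unit_1:
          "tensor_mult I (I \<times> I) mult (tensor_mult I I mult mult)
             (tensor_assoc (tens (\<Delta> unit) unit)) (tens unit (\<Delta> unit))
           = tensor_assoc (tensor_map I I \<Delta> (\<lambda>v. v) (\<Delta> unit))"
    and weak_comult_unit_2:
          "tensor_mult I (I \<times> I) mult (tensor_mult I I mult mult)
             (tens unit (\<Delta> unit)) (tensor_assoc (tens (\<Delta> unit) unit))
           = tensor_assoc (tensor_map I I \<Delta> (\<lambda>v. v) (\<Delta> unit))"
    and weak_counit_mult_1: "\<lbrakk>x \<in> vecs I; y \<in> vecs I; z \<in> vecs I\<rbrakk> \<Longrightarrow>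
           \<epsilon> (mult (mult x y) z) =
             (\<Sum>(a, b)\<in>I \<times> I. \<Delta> y (a, b) * \<epsilon> (mult x (basis_vec a)) * \<epsilon> (mult (basis_vec b) z))"
    and weak_counit_mult_2: "\<lbrakk>x \<in> vecs I; y \<in> vecs I; z \<in> vecs I\<rbrakk> \<Longrightarrow>
           \<epsilon> (mult (mult x y) z) =
             (\<Sum>(a, b)\<in>I \<times> I. \<Delta> y (a, b) * \<epsilon> (mult x (basis_vec b)) * \<epsilon> (mult (basis_vec a) z))"

definition pointwise_mult :: "('a \<Rightarrow> 'k::field) \<Rightarrow> ('a \<Rightarrow> 'k) \<Rightarrow> ('a \<Rightarrow> 'k)" where
  "pointwise_mult u v = (\<lambda>i. u i * v i)"

definition pointwise_unit :: "'a set \<Rightarrow> 'a \<Rightarrow> 'k::field" where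
  "pointwise_unit I = (\<lambda>j. \<Sum>i\<in>I. basis_vec i j)"

text \<open>
  The maps of a structure are extensional, so that two structures are equal as soon as their
  coproducts and counits agree on the vectors with support in 1, ..., n.
\<close>

definition pointwise_wbs ::
    "nat \<Rightarrow> (((nat \<Rightarrow> 'k::field) \<Rightarrow> (nat \<times> nat \<Rightarrow> 'k)) \<times> ((nat \<Rightarrow> 'k) \<Rightarrow> 'k)) set" where
  "pointwise_wbs n =
     {(\<Delta>, \<epsilon>). weak_bialgebra_on {1..n} pointwise_mult (pointwise_unit {1..n}) \<Delta> \<epsilon> \<and>
              \<Delta> \<in> extensional (vecs {1..n}) \<and> \<epsilon> \<in> extensional (vecs {1..n})}"


section \<open>Small categories\<close>

record ('o, 'm) category =
  Obj :: "'o set"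
  Mor :: "'m set"
  Src :: "'m \<Rightarrow> 'o"
  Tgt :: "'m \<Rightarrow> 'o"
  Id :: "'o \<Rightarrow> 'm"
  Comp :: "'m \<times> 'm \<Rightarrow> 'm"

text \<open>Comp C (g, h) is \<open>g \<circ> h\<close>: first h, then g.\<close>

definition composable :: "('o, 'm) category \<Rightarrow> ('m \<times> 'm) set" where
  "composable C = {(g, h). g \<in> Mor C \<and> h \<in> Mor C \<and> Src C g = Tgt C h}"

locale small_category =
  fixes C :: "('o, 'm) category"
  assumes Src_closed: "Src C \<in> Mor C \<rightarrow>\<^sub>E Obj C"
    and Tgt_closed: "Tgt C \<in> Mor C \<rightarrow>\<^sub>E Obj C"
    and Id_closed: "Id C \<in> Obj C \<rightarrow>\<^sub>E Mor C"
    and Comp_closed: "Comp C \<in> composable C \<rightarrow>\<^sub>E Mor C"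
    and Src_Id: "x \<in> Obj C \<Longrightarrow> Src C (Id C x) = x"
    and Tgt_Id: "x \<in> Obj C \<Longrightarrow> Tgt C (Id C x) = x"
    and Src_Comp: "(g, h) \<in> composable C \<Longrightarrow> Src C (Comp C (g, h)) = Src C h"
    and Tgt_Comp: "(g, h) \<in> composable C \<Longrightarrow> Tgt C (Comp C (g, h)) = Tgt C g"
    and Comp_Id_left: "f \<in> Mor C \<Longrightarrow> Comp C (Id C (Tgt C f), f) = f"
    and Comp_Id_right: "f \<in> Mor C \<Longrightarrow> Comp C (f, Id C (Src C f)) = f"
    and Comp_assoc: "\<lbrakk>(f, g) \<in> composable C; (g, h) \<in> composable C\<rbrakk> \<Longrightarrow>
           Comp C (Comp C (f, g), h) = Comp C (f, Comp C (g, h))"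

definition category_iso ::
    "('o, 'm) category \<Rightarrow> ('p, 'q) category \<Rightarrow> ('o \<Rightarrow> 'p) \<Rightarrow> ('m \<Rightarrow> 'q) \<Rightarrow> bool" where
  "category_iso C D \<phi> \<beta> \<longleftrightarrow>
     bij_betw \<phi> (Obj C) (Obj D) \<and> bij_betw \<beta> (Mor C) (Mor D) \<and>
     (\<forall>f\<in>Mor C. Src D (\<beta> f) = \<phi> (Src C f) \<and> Tgt D (\<beta> f) = \<phi> (Tgt C f)) \<and>
     (\<forall>x\<in>Obj C. Id D (\<phi> x) = \<beta> (Id C x)) \<and>
     (\<forall>(g, h)\<in>composable C. Comp D (\<beta> g, \<beta> h) = \<beta> (Comp C (g, h)))"

text \<open>
  Categories whose morphisms are the labels 1, ..., n of the basis vectors and whose objects are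
  identified with their identity morphisms.
\<close>

definition labelled_categories :: "nat \<Rightarrow> (nat, nat) category set" where
  "labelled_categories n =
     {C. small_category C \<and> Mor C = {1..n} \<and> Obj C \<subseteq> {1..n} \<and> (\<forall>x\<in>Obj C. Id C x = x)}"


section \<open>Structures on the space spanned by the morphisms\<close>

definition decompositions :: "('o, 'm) category \<Rightarrow> 'm \<Rightarrow> ('m \<times> 'm) set" where
  "decompositions C f = {(g, h) \<in> composable C. Comp C (g, h) = f}"

text \<open>
  The coproduct is the linear extension of \<open>f \<mapsto> \<Sum> g \<otimes> h\<close>, the sum being over the pairs
  with \<open>g \<circ> h = f\<close>.  It is multiplicative for the pointwise product in which the morphisms are
  orthogonal idempotents.  It is not multiplicative for the composition product
  in general: for the group of order two it satisfies \<open>\<Delta>(1)\<Delta>(1) = 2\<Delta>(1)\<close>.  The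
  composition product is the transpose of this coproduct; it forms a weak bialgebra with the
  transpose of the pointwise product, the diagonal coproduct \<open>f \<mapsto> f \<otimes> f\<close>.
\<close>

definition coprod :: "('o, 'm) category \<Rightarrow> ('m \<Rightarrow> 'k::field) \<Rightarrow> ('m \<times> 'm \<Rightarrow> 'k)" where
  "coprod C v =
     (\<lambda>p. \<Sum>f\<in>Mor C. v f * (\<Sum>(g, h)\<in>decompositions C f. tens (basis_vec g) (basis_vec h) p))"

definition counit :: "('o, 'm) category \<Rightarrow> ('m \<Rightarrow> 'k::field) \<Rightarrow> 'k" where
  "counit C v = (\<Sum>f\<in>Mor C. v f * (if f \<in> Id C ` Obj C then 1 else 0))"

definition comp_mult ::
    "('o, 'm) category \<Rightarrow> ('m \<Rightarrow> 'k::field) \<Rightarrow> ('m \<Rightarrow> 'k) \<Rightarrow> ('m \<Rightarrow> 'k)" where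
  "comp_mult C u v = (\<lambda>f. \<Sum>g\<in>Mor C. \<Sum>h\<in>Mor C. u g * v h *
      (if (g, h) \<in> composable C then basis_vec (Comp C (g, h)) f else 0))"

definition comp_unit :: "('o, 'm) category \<Rightarrow> 'm \<Rightarrow> 'k::field" where
  "comp_unit C = (\<lambda>f. \<Sum>x\<in>Obj C. basis_vec (Id C x) f)"

definition diag_coprod :: "('o, 'm) category \<Rightarrow> ('m \<Rightarrow> 'k::field) \<Rightarrow> ('m \<times> 'm \<Rightarrow> 'k)" where
  "diag_coprod C v = (\<lambda>p. \<Sum>f\<in>Mor C. v f * tens (basis_vec f) (basis_vec f) p)"

definition diag_counit :: "('o, 'm) category \<Rightarrow> ('m \<Rightarrow> 'k::field) \<Rightarrow> 'k" where
  "diag_counit C v = (\<Sum>f\<in>Mor C. v f)"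

end

theory Submission
  imports Defs
begin

text \<open>
  Write \<open>e\<^sub>f\<close> for the basis idempotents and \<open>d(f; g, h)\<close> for the coefficient of
  \<open>e\<^sub>g \<otimes> e\<^sub>h\<close> in \<open>\<Delta>(e\<^sub>f)\<close>.  Multiplicativity of \<open>\<Delta>\<close> for
  the pointwise product says that, for a fixed pair \<open>(g, h)\<close>, the coefficients
  \<open>d(f; g, h)\<close> are orthogonal idempotents of the field.  So at most one of them is nonzero,
  and it equals 1: the coproduct is the graph of a partial operation \<open>(g, h) \<mapsto> g \<circ> h\<close>
  (\<open>comult_basis_mult\<close>).  The other axioms are then properties of this operation.

  Coassociativity says that \<open>(g \<circ> h) \<circ> k\<close> and \<open>g \<circ> (h \<circ> k)\<close> are defined
  under the same conditions and agree.  The weak unit axiom adds that they are defined as soon as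
  \<open>g \<circ> h\<close> and \<open>h \<circ> k\<close> are.  The weak counit axiom at basis vectors reads
  \<open>d(f; i, j) \<epsilon>(e\<^sub>i) \<epsilon>(e\<^sub>j) = \<epsilon>(e\<^sub>f)\<close> if \<open>i = f = j\<close>, and
  \<open>= 0\<close> otherwise.  Hence \<open>\<epsilon>(e\<^sub>i)\<close> is 0 or 1, the indices with value 1 are
  idempotent, and two different ones never compose (\<open>weak_counit_basis\<close>).

  These indices are the identities.  The counit law gives each \<open>f\<close> a unit on either side,
  but counts units only modulo the characteristic.  Uniqueness comes from associativity instead: if
  \<open>u \<circ> f = f\<close> and \<open>i \<circ> f\<close> is defined, then \<open>i \<circ> u\<close> is defined, so
  \<open>i = u\<close> (\<open>left_unit_unique\<close>).  The unique right and left units serve as source and target,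
  and the result is a category whose objects are its identity morphisms.

  Conversely, the coproduct of a finite category is the pullback of functions along composition:
  the coordinate of \<open>\<Delta>(v)\<close> at \<open>(g, h)\<close> is \<open>v(g \<circ> h)\<close>, or 0 if the pair is
  not composable (\<open>coprod_apply\<close>).  With this formula the axioms of a weak bialgebra are those
  of a category (\<open>coprod_weak_bialgebra\<close>).  The two constructions are mutually inverse.  A category
  with an arbitrary set of morphisms and a bijection from the labels is carried to a labelled category,
  and the labelled category is determined by the bijection because identities and factorisations
  are preserved by isomorphisms.

  The category algebra is the dual structure.  Its weak bialgebra axioms are checked on structure
  constants: the diagonal coproduct is multiplicative because a product of morphisms is a morphism
  or zero, and the weak unit axioms hold because the identities are orthogonal idempotents
  (\<open>category_algebra_weak_bialgebra\<close>).
\<close>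

section \<open>Coordinates on tensor products\<close>

lemma basis_vec_apply: "basis_vec i j = of_bool (j = i)"
  by (simp add: basis_vec_def)

lemma basis_vec_in_vecs [simp]: "i \<in> I \<Longrightarrow> basis_vec i \<in> vecs I"
  by (auto simp: vecs_def basis_vec_def)

lemma sum_of_bool_eq:
  assumes "finite A"
  shows "(\<Sum>i\<in>A. f i * of_bool (i = a)) = (if a \<in> A then f a else (0::'k::semiring_1))"
    and "(\<Sum>i\<in>A. f i * of_bool (a = i)) = (if a \<in> A then f a else (0::'k::semiring_1))"
    and "(\<Sum>i\<in>A. of_bool (i = a) * f i) = (if a \<in> A then f a else (0::'k::semiring_1))"
    and "(\<Sum>i\<in>A. of_bool (a = i) * f i) = (if a \<in> A then f a else (0::'k::semiring_1))"
  using assms by (simp_all add: of_bool_def if_distrib[of "\<lambda>x. _ * x"] if_distrib[of "\<lambda>x. x * _"] cong: if_cong)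

lemma sum_of_bool_unique:
  assumes "finite I" and "\<And>a. P a \<Longrightarrow> a \<in> I" and "\<And>a b. P a \<Longrightarrow> P b \<Longrightarrow> a = b"
  shows "(\<Sum>a\<in>I. of_bool (P a)) = (of_bool (\<exists>a. P a) :: 'k::semiring_1)"
proof (cases "\<exists>a. P a")
  case True
  then obtain a where "P a" ..
  then have "P = (\<lambda>b. b = a)" using assms(3) by blast
  then show ?thesis using assms(1) \<open>P a\<close> assms(2) by (auto simp: of_bool_def)
qed simp

lemma linear_map_apply_eq_sum:
  assumes fin: "finite I" and lin: "linear_map I J F" and v: "v \<in> vecs I"
  shows "F v p = (\<Sum>i\<in>I. v i * F (basis_vec i) p)"
proof -
  have add: "\<forall>u\<in>vecs I. \<forall>w\<in>vecs I. F (\<lambda>i. u i + w i) = (\<lambda>j. F u j + F w j)"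
    using lin by (simp add: linear_map_def)
  have zero: "F (\<lambda>_. 0) = (\<lambda>_. 0)"
  proof -
    have "\<forall>c. \<forall>v\<in>vecs I. F (\<lambda>i. c * v i) = (\<lambda>j. c * F v j)"
      using lin by (simp add: linear_map_def)
    from this[rule_format, OF v, of 0] show ?thesis by simp
  qed
  have "F (\<lambda>j. \<Sum>i\<in>A. v i * basis_vec i j) = (\<lambda>p. \<Sum>i\<in>A. v i * F (basis_vec i) p)"
    if "finite A" "A \<subseteq> I" for A
    using that
  proof (induction A rule: finite_induct)
    case empty
    then show ?case using zero by simp
  next
    case (insert a A)
    have 1: "(\<lambda>j. v a * basis_vec a j) \<in> vecs I" "(\<lambda>j. \<Sum>i\<in>A. v i * basis_vec i j) \<in> vecs I"
      using insert.prems by (auto simp: vecs_def basis_vec_def intro!: sum.neutral)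
    have 2: "F (\<lambda>j. v a * basis_vec a j) = (\<lambda>p. v a * F (basis_vec a) p)"
      using lin insert.prems unfolding linear_map_def by simp
    have "F (\<lambda>j. \<Sum>i\<in>insert a A. v i * basis_vec i j)
        = F (\<lambda>j. v a * basis_vec a j + (\<Sum>i\<in>A. v i * basis_vec i j))"
      using insert.hyps by simp
    also have "\<dots> = (\<lambda>p. F (\<lambda>j. v a * basis_vec a j) p + F (\<lambda>j. \<Sum>i\<in>A. v i * basis_vec i j) p)"
      using add[rule_format, OF 1] .
    finally show ?case using 2 insert by simp
  qed
  from this[OF fin order_refl] have "F (\<lambda>j. \<Sum>i\<in>I. v i * basis_vec i j) p = (\<Sum>i\<in>I. v i * F (basis_vec i) p)"
    by metis
  moreover have "(\<lambda>j. \<Sum>i\<in>I. v i * basis_vec i j) = v"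
    using v by (simp only: basis_vec_apply sum_of_bool_eq[OF fin]) (auto simp: vecs_def)
  ultimately show ?thesis by simp
qed

lemma linear_form_eq_sum:
  assumes "finite I" and "linear_form I \<phi>" and "v \<in> vecs I"
  shows "\<phi> v = (\<Sum>i\<in>I. v i * \<phi> (basis_vec i))"
proof -
  have "linear_map I (UNIV :: unit set) (\<lambda>v _. \<phi> v)"
    using assms(2) by (auto simp: linear_map_def linear_form_def vecs_def)
  from linear_map_apply_eq_sum[OF assms(1) this assms(3)] show ?thesis .
qed

lemma pointwise_unit_apply: "finite I \<Longrightarrow> pointwise_unit I j = of_bool (j \<in> I)"
  by (simp add: pointwise_unit_def basis_vec_def of_bool_def)

text \<open>
  The product of basis vectors under the pointwise product is again pointwise on the basis of a
  tensor product, so that iterated tensor products carry the pointwise product too. The hypothesis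
  on \<open>\<nu>\<close> asks for this on basis vectors only, since a tensor product multiplication in
  the role of \<open>\<nu>\<close> is known to agree with the pointwise one only on its own index set.
\<close>

lemma tensor_mult_pointwise:
  assumes "finite I" "finite J"
    and "\<And>b b'. b \<in> J \<Longrightarrow> b' \<in> J \<Longrightarrow>
           \<nu> (basis_vec b) (basis_vec b') = pointwise_mult (basis_vec b) (basis_vec b' :: _ \<Rightarrow> 'k::field)"
  shows "tensor_mult I J pointwise_mult \<nu> s t = (\<lambda>p. if p \<in> I \<times> J then s p * t p else 0)"
proof
  fix p :: "'a \<times> 'b"
  obtain g h where p: "p = (g, h)" by (cases p)
  have *: "tens (pointwise_mult (basis_vec a) (basis_vec a')) (\<nu> (basis_vec b) (basis_vec b')) p
      = of_bool ((a', b') = p) * of_bool ((a, b) = p)"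
    if "b \<in> J" "b' \<in> J" for a a' b b'
    unfolding assms(3)[OF that] by (auto simp: p tens_def pointwise_mult_def basis_vec_def)
  have "tensor_mult I J pointwise_mult \<nu> s t p
      = (\<Sum>x\<in>I \<times> J. \<Sum>y\<in>I \<times> J. s x * t y * (of_bool (y = p) * of_bool (x = p)))"
    unfolding tensor_mult_def split_beta by (intro sum.cong refl) (simp add: * mem_Times_iff)
  also have "\<dots> = (\<Sum>x\<in>I \<times> J. of_bool (x = p) * (\<Sum>y\<in>I \<times> J. s x * t y * of_bool (y = p)))"
    by (simp add: sum_distrib_left mult_ac)
  also have "\<dots> = (if p \<in> I \<times> J then s p * t p else 0)"
    using assms(1,2) by (simp add: sum_of_bool_eq)
  finally show "tensor_mult I J pointwise_mult \<nu> s t p = (if p \<in> I \<times> J then s p * t p else 0)" .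
qed

lemma tensor_mult_pointwise_2:
  assumes "finite I"
  shows "tensor_mult I I pointwise_mult pointwise_mult s t
      = (\<lambda>p. if p \<in> I \<times> I then s p * t p else (0::'k::field))"
  by (intro tensor_mult_pointwise assms refl)

lemma tensor_mult_pointwise_3:
  assumes "finite I"
  shows "tensor_mult I (I \<times> I) pointwise_mult (tensor_mult I I pointwise_mult pointwise_mult) s t
      = (\<lambda>p. if p \<in> I \<times> I \<times> I then s p * t p else (0::'k::field))"
proof (rule tensor_mult_pointwise)
  fix b b' assume "b \<in> I \<times> I" "b' \<in> I \<times> I"
  then show "tensor_mult I I pointwise_mult pointwise_mult (basis_vec b) (basis_vec b')
      = pointwise_mult (basis_vec b) (basis_vec b' :: _ \<Rightarrow> 'k)"
    by (auto simp: tensor_mult_pointwise_2[OF assms] pointwise_mult_def basis_vec_def fun_eq_iff)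
qed (use assms in auto)

lemma tensor_map_id_right:
  assumes "finite I"
  shows "tensor_map I I F (\<lambda>v. v) t (p, k) = (if k \<in> I then \<Sum>a\<in>I. t (a, k) * F (basis_vec a) p else 0)"
proof -
  have "tensor_map I I F (\<lambda>v. v) t (p, k)
      = (\<Sum>a\<in>I. \<Sum>j\<in>I. t (a, j) * F (basis_vec a) p * of_bool (k = j))"
    unfolding tensor_map_def sum.cartesian_product by (simp add: tens_def basis_vec_apply mult_ac)
  also have "\<dots> = (if k \<in> I then \<Sum>a\<in>I. t (a, k) * F (basis_vec a) p else 0)"
    using assms by (simp add: sum_of_bool_eq)
  finally show ?thesis .
qed

lemma tensor_map_id_left:
  assumes "finite I"
  shows "tensor_map I I (\<lambda>v. v) F t (k, p) = (if k \<in> I then \<Sum>a\<in>I. t (k, a) * F (basis_vec a) p else 0)"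
proof -
  have "tensor_map I I (\<lambda>v. v) F t (k, p)
      = (\<Sum>i\<in>I. of_bool (k = i) * (\<Sum>a\<in>I. t (i, a) * F (basis_vec a) p))"
    unfolding tensor_map_def sum.cartesian_product[symmetric] sum_distrib_left
    by (intro sum.cong refl) (auto simp: tens_def basis_vec_apply mult_ac sum.cartesian_product)
  also have "\<dots> = (if k \<in> I then \<Sum>a\<in>I. t (k, a) * F (basis_vec a) p else 0)"
    using assms by (simp add: sum_of_bool_eq)
  finally show ?thesis .
qed

lemma sum_basis_vec_fst:
  assumes "finite I"
  shows "(\<Sum>(i, j)\<in>I \<times> I. t i j * c i * basis_vec j p)
      = (if p \<in> I then \<Sum>i\<in>I. t i p * c i else (0::'k::field))"
  using assms by (simp add: sum.cartesian_product[symmetric] basis_vec_apply sum_of_bool_eq)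

lemma sum_basis_vec_snd:
  assumes "finite I"
  shows "(\<Sum>(i, j)\<in>I \<times> I. t i j * c j * basis_vec i p)
      = (if p \<in> I then \<Sum>j\<in>I. t p j * c j else (0::'k::field))"
  using assms
  by (simp add: sum.cartesian_product[symmetric] basis_vec_apply sum_of_bool_eq
      sum_distrib_right[symmetric])

text \<open>
  The axioms evaluate the coproduct and the counit at vectors supported in \<open>I\<close> only.
  This allows passing between a structure given by a formula and its restriction.
\<close>

lemma weak_bialgebra_on_cong:
  assumes W: "weak_bialgebra_on I \<mu> \<eta> \<Delta> \<epsilon>"
    and \<Delta>: "\<And>v. v \<in> vecs I \<Longrightarrow> \<Delta>' v = \<Delta> v" and \<epsilon>: "\<And>v. v \<in> vecs I \<Longrightarrow> \<epsilon>' v = (\<epsilon> v :: 'k::field)"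
  shows "weak_bialgebra_on I \<mu> \<eta> \<Delta>' \<epsilon>'"
proof -
  interpret W: weak_bialgebra_on I \<mu> \<eta> \<Delta> \<epsilon> by (rule W)
  have add: "(\<lambda>i. u i + v i) \<in> vecs I" if "u \<in> vecs I" "v \<in> vecs I" for u v :: "'a \<Rightarrow> 'k"
    using that by (auto simp: vecs_def)
  have scale: "(\<lambda>i. c * v i) \<in> vecs I" if "v \<in> vecs I" for c and v :: "'a \<Rightarrow> 'k"
    using that by (auto simp: vecs_def)
  have mult: "\<mu> u v \<in> vecs I" if "u \<in> vecs I" "v \<in> vecs I" for u v
    using W.mult_bilinear that by (auto simp: bilinear_mult_def linear_map_def)
  have basis: "\<Delta>' (basis_vec i) = \<Delta> (basis_vec i)" "\<epsilon>' (basis_vec i) = \<epsilon> (basis_vec i)" if "i \<in> I" for i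
    using that \<Delta> \<epsilon> by auto
  have map_left: "tensor_map I I \<Delta>' (\<lambda>v. v) t = tensor_map I I \<Delta> (\<lambda>v. v) t"
    and map_right: "tensor_map I I (\<lambda>v. v) \<Delta>' t = tensor_map I I (\<lambda>v. v) \<Delta> t" for t
    by (auto simp: tensor_map_def basis intro!: ext sum.cong)
  show ?thesis
  proof
    show "linear_map I (I \<times> I) \<Delta>'"
      using W.comult_linear by (auto simp: linear_map_def \<Delta> add scale)
    show "linear_form I \<epsilon>'"
      using W.counit_linear by (auto simp: linear_form_def \<epsilon> add scale)
    show "tensor_assoc (tensor_map I I \<Delta>' (\<lambda>v. v) (\<Delta>' x)) = tensor_map I I (\<lambda>v. v) \<Delta>' (\<Delta>' x)"
      if "x \<in> vecs I" for x
      using W.comult_coassoc[OF that] by (simp add: map_left map_right \<Delta> that)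
    show "(\<lambda>p. \<Sum>(i, j)\<in>I \<times> I. \<Delta>' x (i, j) * \<epsilon>' (basis_vec i) * basis_vec j p) = x"
      if "x \<in> vecs I" for x
      using W.counit_left[OF that] by (simp add: sum_basis_vec_fst[OF W.finite_basis] \<Delta> that basis cong: sum.cong if_cong)
    show "(\<lambda>p. \<Sum>(i, j)\<in>I \<times> I. \<Delta>' x (i, j) * \<epsilon>' (basis_vec j) * basis_vec i p) = x"
      if "x \<in> vecs I" for x
      using W.counit_right[OF that] by (simp add: sum_basis_vec_snd[OF W.finite_basis] \<Delta> that basis cong: sum.cong if_cong)
    show "\<Delta>' (\<mu> x y) = tensor_mult I I \<mu> \<mu> (\<Delta>' x) (\<Delta>' y)" if "x \<in> vecs I" "y \<in> vecs I" for x y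
      using W.comult_mult[OF that] by (simp add: \<Delta> mult that)
    show "tensor_mult I (I \<times> I) \<mu> (tensor_mult I I \<mu> \<mu>) (tensor_assoc (tens (\<Delta>' \<eta>) \<eta>)) (tens \<eta> (\<Delta>' \<eta>))
        = tensor_assoc (tensor_map I I \<Delta>' (\<lambda>v. v) (\<Delta>' \<eta>))"
      "tensor_mult I (I \<times> I) \<mu> (tensor_mult I I \<mu> \<mu>) (tens \<eta> (\<Delta>' \<eta>)) (tensor_assoc (tens (\<Delta>' \<eta>) \<eta>))
        = tensor_assoc (tensor_map I I \<Delta>' (\<lambda>v. v) (\<Delta>' \<eta>))"
      using W.weak_comult_unit_1 W.weak_comult_unit_2 by (simp_all add: map_left \<Delta> W.unit_closed)
    show "\<epsilon>' (\<mu> (\<mu> x y) z)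
        = (\<Sum>(a, b)\<in>I \<times> I. \<Delta>' y (a, b) * \<epsilon>' (\<mu> x (basis_vec a)) * \<epsilon>' (\<mu> (basis_vec b) z))"
      if "x \<in> vecs I" "y \<in> vecs I" "z \<in> vecs I" for x y z
    proof -
      have "\<epsilon>' (\<mu> (\<mu> x y) z) = \<epsilon> (\<mu> (\<mu> x y) z)"
        using that by (simp add: \<epsilon> mult)
      also have "\<dots> = (\<Sum>(a, b)\<in>I \<times> I. \<Delta> y (a, b) * \<epsilon> (\<mu> x (basis_vec a)) * \<epsilon> (\<mu> (basis_vec b) z))"
        using that by (rule W.weak_counit_mult_1)
      also have "\<dots> = (\<Sum>(a, b)\<in>I \<times> I. \<Delta>' y (a, b) * \<epsilon>' (\<mu> x (basis_vec a)) * \<epsilon>' (\<mu> (basis_vec b) z))"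
        using that by (auto simp: \<epsilon> \<Delta> mult intro!: sum.cong)
      finally show ?thesis .
    qed
    show "\<epsilon>' (\<mu> (\<mu> x y) z)
        = (\<Sum>(a, b)\<in>I \<times> I. \<Delta>' y (a, b) * \<epsilon>' (\<mu> x (basis_vec b)) * \<epsilon>' (\<mu> (basis_vec a) z))"
      if "x \<in> vecs I" "y \<in> vecs I" "z \<in> vecs I" for x y z
    proof -
      have "\<epsilon>' (\<mu> (\<mu> x y) z) = \<epsilon> (\<mu> (\<mu> x y) z)"
        using that by (simp add: \<epsilon> mult)
      also have "\<dots> = (\<Sum>(a, b)\<in>I \<times> I. \<Delta> y (a, b) * \<epsilon> (\<mu> x (basis_vec b)) * \<epsilon> (\<mu> (basis_vec a) z))"
        using that by (rule W.weak_counit_mult_2)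
      also have "\<dots> = (\<Sum>(a, b)\<in>I \<times> I. \<Delta>' y (a, b) * \<epsilon>' (\<mu> x (basis_vec b)) * \<epsilon>' (\<mu> (basis_vec a) z))"
        using that by (auto simp: \<epsilon> \<Delta> mult intro!: sum.cong)
      finally show ?thesis .
    qed
  qed
qed

section \<open>The coalgebra of factorisations of a finite category\<close>

locale finite_category = small_category C for C :: "('o, 'm) category" +
  assumes finite_Mor: "finite (Mor C)"
begin

lemma Src_in: "f \<in> Mor C \<Longrightarrow> Src C f \<in> Obj C"
  and Tgt_in: "f \<in> Mor C \<Longrightarrow> Tgt C f \<in> Obj C"
  and Id_in: "x \<in> Obj C \<Longrightarrow> Id C x \<in> Mor C"
  and Comp_in: "(g, h) \<in> composable C \<Longrightarrow> Comp C (g, h) \<in> Mor C"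
  using Src_closed Tgt_closed Id_closed Comp_closed by auto

lemma composableD: "(g, h) \<in> composable C \<Longrightarrow> g \<in> Mor C \<and> h \<in> Mor C"
  by (simp add: composable_def)

lemma composable_Comp_left:
  "(g, h) \<in> composable C \<Longrightarrow> (Comp C (g, h), k) \<in> composable C \<longleftrightarrow> (h, k) \<in> composable C"
  by (auto simp: composable_def Src_Comp Comp_in)

lemma composable_Comp_right:
  "(h, k) \<in> composable C \<Longrightarrow> (g, Comp C (h, k)) \<in> composable C \<longleftrightarrow> (g, h) \<in> composable C"
  by (auto simp: composable_def Tgt_Comp Comp_in)

lemma inj_Id: "inj_on (Id C) (Obj C)"
  by (metis inj_onI Src_Id)

lemma finite_Obj: "finite (Obj C)"
  using inj_Id finite_Mor Id_in by (metis finite_imageD finite_subset image_subsetI)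

lemma composable_Id_left:
  "x \<in> Obj C \<Longrightarrow> (Id C x, h) \<in> composable C \<longleftrightarrow> h \<in> Mor C \<and> x = Tgt C h"
  by (auto simp: composable_def Id_in Src_Id)

lemma composable_Id_right:
  "x \<in> Obj C \<Longrightarrow> (g, Id C x) \<in> composable C \<longleftrightarrow> g \<in> Mor C \<and> x = Src C g"
  by (auto simp: composable_def Id_in Tgt_Id)

text \<open>
  A pair of morphisms has at most one composite, so a coordinate of the coproduct is a single value
  of the vector: the coproduct is the pullback of functions along the composition map, extended by
  zero off the composable pairs. In this form coassociativity is associativity of composition, and
  multiplicativity for the pointwise product is immediate.
\<close>

lemma coprod_apply:
  "coprod C v (g, h) = (if (g, h) \<in> composable C then v (Comp C (g, h)) else (0::'k::field))"
proof -
  have fin: "finite (decompositions C f)" for f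
    by (rule finite_subset[of _ "Mor C \<times> Mor C"])
       (auto simp: decompositions_def composable_def finite_Mor)
  have *: "(\<Sum>(g', h')\<in>decompositions C f. tens (basis_vec g') (basis_vec h') (g, h))
      = of_bool ((g, h) \<in> composable C) * (of_bool (Comp C (g, h) = f) :: 'k)" for f
  proof -
    have "(\<Sum>(g', h')\<in>decompositions C f. tens (basis_vec g') (basis_vec h') (g, h))
        = (\<Sum>q\<in>decompositions C f. (of_bool (q = (g, h)) :: 'k))"
      by (intro sum.cong refl) (auto simp: tens_def basis_vec_def)
    also have "\<dots> = of_bool ((g, h) \<in> decompositions C f)"
      using fin by (simp add: of_bool_def)
    finally show ?thesis by (simp add: decompositions_def)
  qed
  have "coprod C v (g, h)
      = of_bool ((g, h) \<in> composable C) * (\<Sum>f\<in>Mor C. v f * of_bool (Comp C (g, h) = f))"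
    unfolding coprod_def * by (simp add: sum_distrib_left mult_ac)
  then show ?thesis
    using finite_Mor Comp_in by (auto simp: sum_of_bool_eq)
qed

lemma counit_apply: "counit C v = (\<Sum>x\<in>Obj C. (v (Id C x) :: 'k::field))"
proof -
  have "counit C v = (\<Sum>f\<in>Mor C. if f \<in> Id C ` Obj C then v f else 0)"
    by (auto simp: counit_def intro!: sum.cong)
  also have "\<dots> = sum v (Mor C \<inter> Id C ` Obj C)"
    using finite_Mor by (simp add: sum.inter_restrict)
  also have "Mor C \<inter> Id C ` Obj C = Id C ` Obj C"
    using Id_in by auto
  finally show ?thesis by (simp add: sum.reindex[OF inj_Id])
qed

lemma counit_basis_vec:
  "f \<in> Mor C \<Longrightarrow> counit C (basis_vec f) = (of_bool (f \<in> Id C ` Obj C) :: 'k::field)"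
  unfolding counit_def basis_vec_def sum_of_bool_eq(3)[OF finite_Mor] by simp

lemma counit_mult_basis_vec:
  assumes "a \<in> Mor C"
  shows "counit C (pointwise_mult x (basis_vec a)) = x a * (of_bool (a \<in> Id C ` Obj C) :: 'k::field)"
    and "counit C (pointwise_mult (basis_vec a) x) = x a * (of_bool (a \<in> Id C ` Obj C) :: 'k::field)"
proof -
  have eq: "counit C (pointwise_mult x (basis_vec a)) = (\<Sum>f\<in>Mor C. x f * (of_bool (f \<in> Id C ` Obj C) :: 'k) * of_bool (f = a))"
    by (auto simp: counit_def pointwise_mult_def basis_vec_def intro!: sum.cong)
  then show 1: "counit C (pointwise_mult x (basis_vec a)) = x a * (of_bool (a \<in> Id C ` Obj C) :: 'k)"
    using finite_Mor assms by (simp add: sum_of_bool_eq)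
  have "pointwise_mult (basis_vec a) x = pointwise_mult x (basis_vec a)"
    by (simp add: pointwise_mult_def mult.commute)
  with 1 show "counit C (pointwise_mult (basis_vec a) x) = x a * (of_bool (a \<in> Id C ` Obj C) :: 'k)"
    by simp
qed

text \<open>
  Both weak counit axioms reduce to this sum: two identities are composable only if they are
  equal, so that only the diagonal terms at identities survive. The result is symmetric
  in \<open>x\<close> and \<open>z\<close>, which is why the two orders of the Sweedler factors agree.
\<close>

lemma sum_coprod_counit:
  "(\<Sum>(a, b)\<in>Mor C \<times> Mor C. coprod C y (a, b) * (x a * of_bool (a \<in> Id C ` Obj C)) *
        (z b * of_bool (b \<in> Id C ` Obj C)))
    = (\<Sum>w\<in>Obj C. x (Id C w) * y (Id C w) * (z (Id C w) :: 'k::field))"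
proof -
  have *: "coprod C y (a, b) * (x a * of_bool (a \<in> Id C ` Obj C)) * (z b * of_bool (b \<in> Id C ` Obj C))
     = (if a \<in> Id C ` Obj C then (x a * y a * z a) * of_bool (a = b) else 0)"
     if "a \<in> Mor C" "b \<in> Mor C" for a b
  proof (cases "a \<in> Id C ` Obj C \<and> b \<in> Id C ` Obj C")
    case True
    then obtain u w where uw: "u \<in> Obj C" "w \<in> Obj C" "a = Id C u" "b = Id C w" by auto
    show ?thesis
    proof (cases "u = w")
      case True
      then have "(a, b) \<in> composable C" "Comp C (a, b) = a"
        using uw Comp_Id_left[of b] by (auto simp: composable_Id_left Id_in Tgt_Id)
      then show ?thesis using uw True by (simp add: coprod_apply)
    next
      case False
      then have "(a, b) \<notin> composable C" "a \<noteq> b"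
        using uw inj_Id by (auto simp: composable_Id_left Tgt_Id inj_on_def)
      then show ?thesis by (simp add: coprod_apply)
    qed
  qed auto
  have "(\<Sum>(a, b)\<in>Mor C \<times> Mor C. coprod C y (a, b) * (x a * of_bool (a \<in> Id C ` Obj C)) *
        (z b * of_bool (b \<in> Id C ` Obj C)))
     = (\<Sum>a\<in>Mor C. \<Sum>b\<in>Mor C. if a \<in> Id C ` Obj C then (x a * y a * z a) * of_bool (a = b) else 0)"
    unfolding sum.cartesian_product by (intro sum.cong refl) (auto simp: *)
  also have "\<dots> = (\<Sum>a\<in>Mor C. x a * y a * z a * (if a \<in> Id C ` Obj C then 1 else 0))"
  proof (intro sum.cong refl)
    fix a assume "a \<in> Mor C"
    then show "(\<Sum>b\<in>Mor C. if a \<in> Id C ` Obj C then (x a * y a * z a) * of_bool (a = b) else 0)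
       = x a * y a * z a * (if a \<in> Id C ` Obj C then 1 else 0)"
      using finite_Mor by (cases "a \<in> Id C ` Obj C") (simp_all add: sum_of_bool_eq)
  qed
  also have "\<dots> = counit C (\<lambda>a. x a * y a * z a)"
    by (simp add: counit_def)
  finally show ?thesis by (simp add: counit_apply)
qed

text \<open>
  Both sides of the weak unit axiom are the indicator function of the triples with
  \<open>(g, h)\<close> and \<open>(h, k)\<close> composable, because \<open>(g \<circ> h, k)\<close> is composable
  exactly when \<open>(h, k)\<close> is.
\<close>

theorem coprod_weak_bialgebra:
  "weak_bialgebra_on (Mor C) pointwise_mult (pointwise_unit (Mor C))
     (coprod C :: ('m \<Rightarrow> 'k::field) \<Rightarrow> _) (counit C)"
proof
  let ?M = "Mor C" and ?\<Delta> = "coprod C :: ('m \<Rightarrow> 'k) \<Rightarrow> _"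
  note fin = finite_Mor
  have assoc_left: "tensor_assoc (tensor_map ?M ?M ?\<Delta> (\<lambda>v. v) (?\<Delta> x)) (g, (h, k))
      = (if (g, h) \<in> composable C \<and> (h, k) \<in> composable C then x (Comp C (Comp C (g, h), k)) else 0)"
    for x g h k
  proof -
    have "tensor_assoc (tensor_map ?M ?M ?\<Delta> (\<lambda>v. v) (?\<Delta> x)) (g, (h, k))
       = (if k \<in> ?M then \<Sum>a\<in>?M. ?\<Delta> x (a, k) * ?\<Delta> (basis_vec a) (g, h) else 0)"
      by (simp add: tensor_assoc_def tensor_map_id_right[OF fin])
    also have "\<dots> = (if k \<in> ?M \<and> (g, h) \<in> composable C then ?\<Delta> x (Comp C (g, h), k) else 0)"
      using fin by (auto simp: coprod_apply[of "basis_vec _"] basis_vec_apply sum_of_bool_eq Comp_in)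
    finally show ?thesis
      by (auto simp: coprod_apply composable_Comp_left dest: composableD)
  qed
  show "finite ?M" by (rule fin)
  show "bilinear_mult ?M (pointwise_mult :: ('m \<Rightarrow> 'k) \<Rightarrow> _)"
    by (auto simp: bilinear_mult_def linear_map_def vecs_def pointwise_mult_def algebra_simps)
  show "pointwise_unit ?M \<in> vecs ?M"
    by (simp add: vecs_def pointwise_unit_apply fin)
  show "pointwise_mult (pointwise_mult x y) z = pointwise_mult x (pointwise_mult y z)"
    for x y z :: "'m \<Rightarrow> 'k" by (simp add: pointwise_mult_def mult_ac)
  show "pointwise_mult (pointwise_unit ?M) x = x" "pointwise_mult x (pointwise_unit ?M) = x"
    if "x \<in> vecs ?M" for x :: "'m \<Rightarrow> 'k"
    using that by (auto simp: pointwise_mult_def pointwise_unit_apply fin vecs_def fun_eq_iff)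
  show "linear_map ?M (?M \<times> ?M) ?\<Delta>"
    by (auto simp: linear_map_def vecs_def coprod_apply fun_eq_iff dest: composableD)
  show "linear_form ?M (counit C :: ('m \<Rightarrow> 'k) \<Rightarrow> _)"
    by (simp add: linear_form_def counit_apply sum.distrib sum_distrib_left)
  show "tensor_assoc (tensor_map ?M ?M ?\<Delta> (\<lambda>v. v) (?\<Delta> x)) = tensor_map ?M ?M (\<lambda>v. v) ?\<Delta> (?\<Delta> x)"
    for x
  proof
    fix p :: "'m \<times> 'm \<times> 'm"
    obtain g h k where p: "p = (g, h, k)" by (metis prod.collapse)
    have "tensor_map ?M ?M (\<lambda>v. v) ?\<Delta> (?\<Delta> x) p
       = (if g \<in> ?M then \<Sum>a\<in>?M. ?\<Delta> x (g, a) * ?\<Delta> (basis_vec a) (h, k) else 0)"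
      by (simp add: p tensor_map_id_left[OF fin])
    also have "\<dots> = (if g \<in> ?M \<and> (h, k) \<in> composable C then ?\<Delta> x (g, Comp C (h, k)) else 0)"
      using fin by (auto simp: coprod_apply[of "basis_vec _"] basis_vec_apply sum_of_bool_eq Comp_in)
    also have "\<dots> = (if (g, h) \<in> composable C \<and> (h, k) \<in> composable C
        then x (Comp C (g, Comp C (h, k))) else 0)"
      by (auto simp: coprod_apply composable_Comp_right dest: composableD)
    finally show "tensor_assoc (tensor_map ?M ?M ?\<Delta> (\<lambda>v. v) (?\<Delta> x)) p
        = tensor_map ?M ?M (\<lambda>v. v) ?\<Delta> (?\<Delta> x) p"
      by (simp add: p assoc_left Comp_assoc)
  qed
  show "(\<lambda>p. \<Sum>(i, j)\<in>?M \<times> ?M. ?\<Delta> x (i, j) * counit C (basis_vec i) * basis_vec j p) = x"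
    if x: "x \<in> vecs ?M" for x
  proof
    fix p
    have *: "(\<Sum>i\<in>?M. ?\<Delta> x (i, p) * counit C (basis_vec i)) = x p" if p: "p \<in> ?M"
    proof -
      \<comment> \<open>Exactly one identity can be composed with \<open>p\<close> on the left, namely that of its target.\<close>
      have "(\<Sum>i\<in>?M. ?\<Delta> x (i, p) * counit C (basis_vec i)) = counit C (\<lambda>i. ?\<Delta> x (i, p))"
        by (simp add: counit_def[of C "\<lambda>i. ?\<Delta> x (i, p)"] counit_basis_vec of_bool_def)
      also have "\<dots> = (\<Sum>w\<in>Obj C. if Tgt C p = w then x p else 0)"
        using p by (auto simp: counit_apply coprod_apply composable_Id_left Comp_Id_left intro!: sum.cong)
      finally show ?thesis using finite_Obj p by (simp add: Tgt_in)
    qed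
    show "(\<Sum>(i, j)\<in>?M \<times> ?M. ?\<Delta> x (i, j) * counit C (basis_vec i) * basis_vec j p) = x p"
      using x by (auto simp: sum_basis_vec_fst[OF fin] * vecs_def)
  qed
  show "(\<lambda>p. \<Sum>(i, j)\<in>?M \<times> ?M. ?\<Delta> x (i, j) * counit C (basis_vec j) * basis_vec i p) = x"
    if x: "x \<in> vecs ?M" for x
  proof
    fix p
    have *: "(\<Sum>j\<in>?M. ?\<Delta> x (p, j) * counit C (basis_vec j)) = x p" if p: "p \<in> ?M"
    proof -
      have "(\<Sum>j\<in>?M. ?\<Delta> x (p, j) * counit C (basis_vec j)) = counit C (\<lambda>j. ?\<Delta> x (p, j))"
        by (simp add: counit_def[of C "\<lambda>j. ?\<Delta> x (p, j)"] counit_basis_vec of_bool_def)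
      also have "\<dots> = (\<Sum>w\<in>Obj C. if Src C p = w then x p else 0)"
        using p by (auto simp: counit_apply coprod_apply composable_Id_right Comp_Id_right intro!: sum.cong)
      finally show ?thesis using finite_Obj p by (simp add: Src_in)
    qed
    show "(\<Sum>(i, j)\<in>?M \<times> ?M. ?\<Delta> x (i, j) * counit C (basis_vec j) * basis_vec i p) = x p"
      using x by (auto simp: sum_basis_vec_snd[OF fin] * vecs_def)
  qed
  show "?\<Delta> (pointwise_mult x y) = tensor_mult ?M ?M pointwise_mult pointwise_mult (?\<Delta> x) (?\<Delta> y)" for x y
    by (auto simp: tensor_mult_pointwise_2[OF fin] coprod_apply pointwise_mult_def fun_eq_iff dest: composableD)
  show weak_unit: "tensor_mult ?M (?M \<times> ?M) pointwise_mult (tensor_mult ?M ?M pointwise_mult pointwise_mult)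
           (tensor_assoc (tens (?\<Delta> (pointwise_unit ?M)) (pointwise_unit ?M)))
           (tens (pointwise_unit ?M) (?\<Delta> (pointwise_unit ?M)))
         = tensor_assoc (tensor_map ?M ?M ?\<Delta> (\<lambda>v. v) (?\<Delta> (pointwise_unit ?M)))"
  proof
    fix p :: "'m \<times> 'm \<times> 'm"
    obtain g h k where p: "p = (g, h, k)" by (metis prod.collapse)
    show "tensor_mult ?M (?M \<times> ?M) pointwise_mult (tensor_mult ?M ?M pointwise_mult pointwise_mult)
           (tensor_assoc (tens (?\<Delta> (pointwise_unit ?M)) (pointwise_unit ?M)))
           (tens (pointwise_unit ?M) (?\<Delta> (pointwise_unit ?M))) p
         = tensor_assoc (tensor_map ?M ?M ?\<Delta> (\<lambda>v. v) (?\<Delta> (pointwise_unit ?M))) p"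
      unfolding p assoc_left tensor_mult_pointwise_3[OF fin]
      by (auto simp: tensor_assoc_def tens_def coprod_apply pointwise_unit_apply[OF fin]
          Comp_in composable_Comp_left dest: composableD)
  qed
  show "tensor_mult ?M (?M \<times> ?M) pointwise_mult (tensor_mult ?M ?M pointwise_mult pointwise_mult)
           (tens (pointwise_unit ?M) (?\<Delta> (pointwise_unit ?M)))
           (tensor_assoc (tens (?\<Delta> (pointwise_unit ?M)) (pointwise_unit ?M)))
         = tensor_assoc (tensor_map ?M ?M ?\<Delta> (\<lambda>v. v) (?\<Delta> (pointwise_unit ?M)))"
    unfolding weak_unit[symmetric] tensor_mult_pointwise_3[OF fin]
    by (intro ext) (simp add: mult.commute)
  show "counit C (pointwise_mult (pointwise_mult x y) z) =
          (\<Sum>(a, b)\<in>?M \<times> ?M. ?\<Delta> y (a, b) * counit C (pointwise_mult x (basis_vec a)) *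
             counit C (pointwise_mult (basis_vec b) z))" for x y z
  proof -
    have "(\<Sum>(a, b)\<in>?M \<times> ?M. ?\<Delta> y (a, b) * counit C (pointwise_mult x (basis_vec a)) *
             counit C (pointwise_mult (basis_vec b) z)) =
      (\<Sum>(a, b)\<in>?M \<times> ?M. coprod C y (a, b) * (x a * of_bool (a \<in> Id C ` Obj C)) *
        (z b * of_bool (b \<in> Id C ` Obj C)))"
      by (intro sum.cong refl) (auto simp: counit_mult_basis_vec)
    then show ?thesis
      unfolding sum_coprod_counit by (simp add: counit_apply pointwise_mult_def)
  qed
  show "counit C (pointwise_mult (pointwise_mult x y) z) =
          (\<Sum>(a, b)\<in>?M \<times> ?M. ?\<Delta> y (a, b) * counit C (pointwise_mult x (basis_vec b)) *
             counit C (pointwise_mult (basis_vec a) z))" for x y z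
  proof -
    have "(\<Sum>(a, b)\<in>?M \<times> ?M. ?\<Delta> y (a, b) * counit C (pointwise_mult x (basis_vec b)) *
             counit C (pointwise_mult (basis_vec a) z)) =
      (\<Sum>(a, b)\<in>?M \<times> ?M. coprod C y (a, b) * (z a * of_bool (a \<in> Id C ` Obj C)) *
        (x b * of_bool (b \<in> Id C ` Obj C)))"
      by (intro sum.cong refl) (auto simp: counit_mult_basis_vec mult_ac)
    then show ?thesis
      unfolding sum_coprod_counit by (simp add: counit_apply pointwise_mult_def mult_ac)
  qed
qed

end

section \<open>The category algebra with the diagonal coproduct\<close>

lemma sum_rotate_3:
  "(\<Sum>p\<in>A. \<Sum>g\<in>B. \<Sum>h\<in>D. F p g h) = (\<Sum>g\<in>B. \<Sum>h\<in>D. \<Sum>p\<in>A. F p g h)"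
  by (subst sum.swap, rule sum.cong[OF refl], rule sum.swap)

lemma sum_rotate_4:
  "(\<Sum>p\<in>A. \<Sum>k\<in>K. \<Sum>g\<in>B. \<Sum>h\<in>D. F p k g h) = (\<Sum>k\<in>K. \<Sum>g\<in>B. \<Sum>h\<in>D. \<Sum>p\<in>A. F p k g h)"
  by (subst sum.swap, rule sum.cong[OF refl], rule sum_rotate_3)

context finite_category
begin

text \<open>
  The structure constants of the category algebra, which are also the coordinates of the
  factorisation coproduct.
\<close>

definition comp_coeff :: "'m \<Rightarrow> 'm \<Rightarrow> 'm \<Rightarrow> 'k::field" where
  "comp_coeff g h f = of_bool ((g, h) \<in> composable C \<and> Comp C (g, h) = f)"

lemma comp_mult_apply:
  "comp_mult C u v f = (\<Sum>g\<in>Mor C. \<Sum>h\<in>Mor C. u g * v h * (comp_coeff g h f :: 'k::field))"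
  unfolding comp_mult_def comp_coeff_def by (intro sum.cong refl) (auto simp: basis_vec_def)

lemma comp_mult_basis_vec:
  assumes "g \<in> Mor C" "h \<in> Mor C"
  shows "comp_mult C (basis_vec g) (basis_vec h) f = (comp_coeff g h f :: 'k::field)"
  using assms finite_Mor
  by (simp add: comp_mult_apply basis_vec_apply mult.assoc sum_distrib_left[symmetric] sum_of_bool_eq)

lemma comp_coeff_notin: "f \<notin> Mor C \<Longrightarrow> comp_coeff g h f = (0 :: 'k::field)"
  using Comp_in by (auto simp: comp_coeff_def)

lemma sum_comp_coeff:
  "(\<Sum>p\<in>Mor C. comp_coeff g h p * \<gamma> p)
     = (if (g, h) \<in> composable C then \<gamma> (Comp C (g, h)) else (0 :: 'k::field))"
  using finite_Mor Comp_in by (auto simp: comp_coeff_def sum_of_bool_eq)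

text \<open>
  Expanding in structure constants reduces associativity to basis vectors, where both sides are the
  indicator of the triples that compose to \<open>f\<close>.
\<close>

lemma comp_mult_assoc:
  "comp_mult C (comp_mult C x y) z = comp_mult C x (comp_mult C y (z :: 'm \<Rightarrow> 'k::field))"
proof
  fix f
  let ?M = "Mor C" and ?c = "comp_coeff :: 'm \<Rightarrow> 'm \<Rightarrow> 'm \<Rightarrow> 'k"
  have coeff: "(\<Sum>p\<in>?M. ?c g h p * ?c p k f) = (\<Sum>p\<in>?M. ?c h k p * ?c g p f)" for g h k
    unfolding sum_comp_coeff
    by (auto simp: comp_coeff_def composable_Comp_left composable_Comp_right Comp_assoc)
  have "comp_mult C (comp_mult C x y) z f
      = (\<Sum>p\<in>?M. \<Sum>k\<in>?M. \<Sum>g\<in>?M. \<Sum>h\<in>?M. x g * y h * z k * (?c g h p * ?c p k f))"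
    by (simp add: comp_mult_apply sum_distrib_left sum_distrib_right mult_ac)
  also have "\<dots> = (\<Sum>k\<in>?M. \<Sum>g\<in>?M. \<Sum>h\<in>?M. \<Sum>p\<in>?M. x g * y h * z k * (?c g h p * ?c p k f))"
    by (rule sum_rotate_4)
  also have "\<dots> = (\<Sum>k\<in>?M. \<Sum>g\<in>?M. \<Sum>h\<in>?M. x g * y h * z k * (\<Sum>p\<in>?M. ?c h k p * ?c g p f))"
    by (simp only: sum_distrib_left[symmetric] coeff)
  also have "\<dots> = (\<Sum>g\<in>?M. \<Sum>p\<in>?M. \<Sum>h\<in>?M. \<Sum>k\<in>?M. x g * y h * z k * (?c h k p * ?c g p f))"
    unfolding sum_distrib_left by (subst sum_rotate_4, rule sum.cong[OF refl], rule sum.swap)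
  also have "\<dots> = comp_mult C x (comp_mult C y z) f"
    by (simp add: comp_mult_apply sum_distrib_left sum_distrib_right mult_ac)
  finally show "comp_mult C (comp_mult C x y) z f = comp_mult C x (comp_mult C y z) f" .
qed

lemma comp_unit_apply: "comp_unit C f = (of_bool (f \<in> Id C ` Obj C) :: 'k::field)"
proof -
  have "comp_unit C f = (\<Sum>i\<in>Id C ` Obj C. (of_bool (f = i) :: 'k))"
    by (simp add: comp_unit_def basis_vec_apply sum.reindex[OF inj_Id])
  then show ?thesis using finite_Obj by (simp add: of_bool_def)
qed

lemma sum_comp_unit: "(\<Sum>f\<in>Mor C. comp_unit C f * \<gamma> f) = (\<Sum>x\<in>Obj C. (\<gamma> (Id C x) :: 'k::field))"
  using counit_apply[of \<gamma>] by (simp add: counit_def comp_unit_apply of_bool_def mult.commute)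

lemma diag_coprod_apply:
  "diag_coprod C v (g, h) = (if g = h \<and> g \<in> Mor C then v g else (0 :: 'k::field))"
proof -
  have "diag_coprod C v (g, h) = (\<Sum>f\<in>Mor C. v f * of_bool (h = f) * of_bool (g = f))"
    by (simp add: diag_coprod_def tens_def basis_vec_apply mult_ac)
  then show ?thesis using finite_Mor by (auto simp: sum_of_bool_eq)
qed

lemma diag_counit_basis_vec: "f \<in> Mor C \<Longrightarrow> diag_counit C (basis_vec f) = (1 :: 'k::field)"
  using finite_Mor by (simp add: diag_counit_def basis_vec_apply of_bool_def)

lemma diag_counit_comp_mult:
  "diag_counit C (comp_mult C u v)
     = (\<Sum>g\<in>Mor C. \<Sum>h\<in>Mor C. u g * v h * (of_bool ((g, h) \<in> composable C) :: 'k::field))"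
proof -
  have "diag_counit C (comp_mult C u v)
      = (\<Sum>g\<in>Mor C. \<Sum>h\<in>Mor C. \<Sum>f\<in>Mor C. u g * v h * (comp_coeff g h f * (1 :: 'k)))"
    unfolding diag_counit_def comp_mult_apply
    by (subst sum_rotate_3) simp
  also have "\<dots> = (\<Sum>g\<in>Mor C. \<Sum>h\<in>Mor C. u g * v h * (of_bool ((g, h) \<in> composable C) :: 'k))"
    unfolding sum_distrib_left[symmetric] sum_comp_coeff by (simp add: of_bool_def)
  finally show ?thesis .
qed

lemma sum_diag_coprod:
  "(\<Sum>(a, b)\<in>Mor C \<times> Mor C. diag_coprod C y (a, b) * \<beta> a b) = (\<Sum>a\<in>Mor C. y a * (\<beta> a a :: 'k::field))"
proof -
  have "(\<Sum>(a, b)\<in>Mor C \<times> Mor C. diag_coprod C y (a, b) * \<beta> a b)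
     = (\<Sum>a\<in>Mor C. \<Sum>b\<in>Mor C. y a * \<beta> a b * of_bool (a = b))"
    unfolding sum.cartesian_product by (intro sum.cong refl) (auto simp: diag_coprod_apply)
  then show ?thesis using finite_Mor by (simp add: sum_of_bool_eq)
qed

lemma tensor_mult_comp_basis:
  assumes "q \<in> Mor C \<times> Mor C" "q' \<in> Mor C \<times> Mor C"
  shows "tensor_mult (Mor C) (Mor C) (comp_mult C) (comp_mult C) (basis_vec q) (basis_vec q') p
     = (comp_coeff (fst q) (fst q') (fst p) * comp_coeff (snd q) (snd q') (snd p) :: 'k::field)"
proof -
  have "tensor_mult (Mor C) (Mor C) (comp_mult C) (comp_mult C) (basis_vec q) (basis_vec q') p
     = (\<Sum>x\<in>Mor C \<times> Mor C. of_bool (x = q) * (\<Sum>y\<in>Mor C \<times> Mor C. of_bool (y = q') *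
         tens (comp_mult C (basis_vec (fst x)) (basis_vec (fst y)))
           (comp_mult C (basis_vec (snd x)) (basis_vec (snd y))) p :: 'k))"
    unfolding tensor_mult_def split_beta sum_distrib_left
    by (simp add: basis_vec_apply mult.assoc)
  also have "\<dots> = tens (comp_mult C (basis_vec (fst q)) (basis_vec (fst q')))
           (comp_mult C (basis_vec (snd q)) (basis_vec (snd q'))) p"
    using assms finite_Mor by (simp add: sum_of_bool_eq)
  also have "\<dots> = comp_coeff (fst q) (fst q') (fst p) * comp_coeff (snd q) (snd q') (snd p)"
    using assms by (auto simp: tens_def split_beta comp_mult_basis_vec mem_Times_iff)
  finally show ?thesis .
qed

text \<open>
  Composing basis vectors gives a basis vector or zero, and the diagonal coproduct doubles basis
  vectors. In coordinates: two structure constants for the same factors but distinct composites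
  have product zero, and a structure constant is idempotent.
\<close>

lemma tensor_mult_diag:
  "tensor_mult (Mor C) (Mor C) (comp_mult C) (comp_mult C) (diag_coprod C x) (diag_coprod C y)
     = diag_coprod C (comp_mult C x (y :: 'm \<Rightarrow> 'k::field))"
proof
  fix p :: "'m \<times> 'm"
  obtain f f' where p: "p = (f, f')" by (cases p)
  let ?M = "Mor C"
  have "tensor_mult ?M ?M (comp_mult C) (comp_mult C) (diag_coprod C x) (diag_coprod C y) p
     = (\<Sum>(a, b)\<in>?M \<times> ?M. diag_coprod C x (a, b) * (\<Sum>(a', b')\<in>?M \<times> ?M. diag_coprod C y (a', b') *
          (comp_coeff a a' f * comp_coeff b b' f')))"
    unfolding tensor_mult_def split_beta sum_distrib_left
    by (intro sum.cong refl) (auto simp: p tens_def comp_mult_basis_vec mult_ac)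
  also have "\<dots> = (\<Sum>a\<in>?M. \<Sum>a'\<in>?M. x a * y a' * (comp_coeff a a' f * comp_coeff a a' f'))"
    unfolding sum_diag_coprod by (simp add: sum_distrib_left mult.assoc)
  also have "\<dots> = diag_coprod C (comp_mult C x y) p"
  proof (cases "f = f' \<and> f \<in> ?M")
    case True
    have idem: "comp_coeff a a' q * comp_coeff a a' q = (comp_coeff a a' q :: 'k)" for a a' q
      by (simp add: comp_coeff_def)
    from True show ?thesis
      by (auto simp: p idem diag_coprod_apply comp_mult_apply)
  next
    case False
    then have zero: "comp_coeff a a' f * comp_coeff a a' f' = (0 :: 'k)" for a a'
      using Comp_in by (auto simp: comp_coeff_def)
    from False show ?thesis by (auto simp: p zero diag_coprod_apply)
  qed
  finally show "tensor_mult ?M ?M (comp_mult C) (comp_mult C) (diag_coprod C x) (diag_coprod C y) p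
     = diag_coprod C (comp_mult C x y) p" .
qed

lemma comp_unit_left: "x \<in> vecs (Mor C) \<Longrightarrow> comp_mult C (comp_unit C) x = (x :: 'm \<Rightarrow> 'k::field)"
proof
  fix f assume x: "x \<in> vecs (Mor C)"
  have "comp_mult C (comp_unit C) x f = (\<Sum>w\<in>Obj C. \<Sum>h\<in>Mor C. x h * comp_coeff (Id C w) h f)"
    unfolding comp_mult_apply sum_comp_unit[of "\<lambda>g. \<Sum>h\<in>Mor C. x h * comp_coeff g h f", symmetric]
    by (simp add: sum_distrib_left mult_ac)
  also have "\<dots> = (\<Sum>w\<in>Obj C. \<Sum>h\<in>Mor C. of_bool (Tgt C h = w) * (x h * of_bool (h = f)))"
    by (intro sum.cong refl) (auto simp: comp_coeff_def composable_Id_left Comp_Id_left)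
  also have "\<dots> = (\<Sum>h\<in>Mor C. x h * of_bool (h = f))"
    using finite_Obj by (subst sum.swap) (simp add: sum_of_bool_eq Tgt_in cong: sum.cong)
  also have "\<dots> = x f"
    using x by (simp only: sum_of_bool_eq[OF finite_Mor]) (auto simp: vecs_def)
  finally show "comp_mult C (comp_unit C) x f = x f" .
qed

lemma comp_unit_right: "x \<in> vecs (Mor C) \<Longrightarrow> comp_mult C x (comp_unit C) = (x :: 'm \<Rightarrow> 'k::field)"
proof
  fix f assume x: "x \<in> vecs (Mor C)"
  have "comp_mult C x (comp_unit C) f = (\<Sum>g\<in>Mor C. \<Sum>w\<in>Obj C. x g * comp_coeff g (Id C w) f)"
    unfolding comp_mult_apply
    using sum_comp_unit[of "\<lambda>h. x g * comp_coeff g h f" for g, symmetric] by (simp add: mult_ac)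
  also have "\<dots> = (\<Sum>g\<in>Mor C. \<Sum>w\<in>Obj C. of_bool (Src C g = w) * (x g * of_bool (g = f)))"
    by (intro sum.cong refl) (auto simp: comp_coeff_def composable_Id_right Comp_Id_right)
  also have "\<dots> = (\<Sum>g\<in>Mor C. x g * of_bool (g = f))"
    using finite_Obj by (simp add: sum_of_bool_eq Src_in cong: sum.cong)
  also have "\<dots> = x f"
    using x by (simp only: sum_of_bool_eq[OF finite_Mor]) (auto simp: vecs_def)
  finally show "comp_mult C x (comp_unit C) f = x f" .
qed

lemma comp_coeff_Id:
  assumes "g \<in> Id C ` Obj C" "h \<in> Id C ` Obj C"
  shows "comp_coeff g h f = (of_bool (g = h \<and> f = g) :: 'k::field)"
proof -
  obtain u w where uw: "u \<in> Obj C" "w \<in> Obj C" "g = Id C u" "h = Id C w" using assms by auto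
  have "(g, h) \<in> composable C \<longleftrightarrow> g = h"
    using uw inj_Id by (auto simp: composable_Id_left Id_in Tgt_Id inj_on_def)
  moreover have "Comp C (g, g) = g"
    using Comp_Id_left[of g] uw by (simp add: Tgt_Id Id_in)
  ultimately show ?thesis by (auto simp: comp_coeff_def)
qed

text \<open>
  The identities are orthogonal idempotents of the category algebra. On tensors supported on
  triples of identities the multiplication of the triple tensor product is therefore pointwise. Both
  factors in the weak unit axioms are of this kind, since the unit is the sum of
  the identities.
\<close>

lemma tensor_mult_comp_3:
  fixes s t :: "'m \<times> 'm \<times> 'm \<Rightarrow> 'k::field"
  assumes s: "\<And>a b c. s (a, b, c) \<noteq> 0 \<Longrightarrow> {a, b, c} \<subseteq> Id C ` Obj C"
    and t: "\<And>a b c. t (a, b, c) \<noteq> 0 \<Longrightarrow> {a, b, c} \<subseteq> Id C ` Obj C"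
  shows "tensor_mult (Mor C) (Mor C \<times> Mor C) (comp_mult C)
      (tensor_mult (Mor C) (Mor C) (comp_mult C) (comp_mult C)) s t
    = (\<lambda>p. if p \<in> Mor C \<times> Mor C \<times> Mor C then s p * t p else 0)"
proof
  fix p :: "'m \<times> 'm \<times> 'm"
  let ?M = "Mor C" and ?\<nu> = "tensor_mult (Mor C) (Mor C) (comp_mult C) (comp_mult C) :: ('m \<times> 'm \<Rightarrow> 'k) \<Rightarrow> _"
  have *: "s x * t y * tens (comp_mult C (basis_vec (fst x)) (basis_vec (fst y)))
      (?\<nu> (basis_vec (snd x)) (basis_vec (snd y))) p
      = of_bool (x = p) * (s x * t y * of_bool (y = p))"
    if x: "x \<in> ?M \<times> ?M \<times> ?M" and y: "y \<in> ?M \<times> ?M \<times> ?M" for x y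
  proof (cases "s x = 0 \<or> t y = 0")
    case False
    obtain a b c a' b' c' where xy: "x = (a, b, c)" "y = (a', b', c')" by (metis prod.collapse)
    have ids: "{a, b, c} \<subseteq> Id C ` Obj C" "{a', b', c'} \<subseteq> Id C ` Obj C"
      using s[of a b c] t[of a' b' c'] x y False by (auto simp: xy)
    show ?thesis
      using x y ids
      by (cases p) (auto simp: xy tens_def comp_mult_basis_vec tensor_mult_comp_basis comp_coeff_Id)
  qed auto
  have "tensor_mult ?M (?M \<times> ?M) (comp_mult C) ?\<nu> s t p
      = (\<Sum>x\<in>?M \<times> ?M \<times> ?M. \<Sum>y\<in>?M \<times> ?M \<times> ?M. of_bool (x = p) * (s x * t y * of_bool (y = p)))"
    unfolding tensor_mult_def[of ?M "?M \<times> ?M"] split_beta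
    by (intro sum.cong refl) (simp add: *)
  also have "\<dots> = (if p \<in> ?M \<times> ?M \<times> ?M then s p * t p else 0)"
    using finite_Mor unfolding sum_distrib_left[symmetric] by (simp add: sum_of_bool_eq)
  finally show "tensor_mult ?M (?M \<times> ?M) (comp_mult C) ?\<nu> s t p
      = (if p \<in> ?M \<times> ?M \<times> ?M then s p * t p else 0)" .
qed

text \<open>
  The counit sends every morphism to 1, so it detects whether a product of morphisms is zero. The
  weak counit axioms then say that \<open>(g, a, k)\<close> is a composable triple as soon as
  \<open>(g, a)\<close> and \<open>(a, k)\<close> are composable pairs.
\<close>

theorem category_algebra_weak_bialgebra:
  "weak_bialgebra_on (Mor C) (comp_mult C) (comp_unit C)
     (diag_coprod C :: ('m \<Rightarrow> 'k::field) \<Rightarrow> _) (diag_counit C)"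
proof
  let ?M = "Mor C" and ?\<Delta> = "diag_coprod C :: ('m \<Rightarrow> 'k) \<Rightarrow> _" and ?e = "comp_unit C :: 'm \<Rightarrow> 'k"
  let ?\<nu> = "tensor_mult ?M ?M (comp_mult C) (comp_mult C) :: ('m \<times> 'm \<Rightarrow> 'k) \<Rightarrow> _"
  note fin = finite_Mor
  have assoc_left: "tensor_assoc (tensor_map ?M ?M ?\<Delta> (\<lambda>v. v) (?\<Delta> x)) (g, (h, k))
      = (if g = h \<and> h = k \<and> k \<in> ?M then x k else 0)" for x g h k
  proof -
    have "?\<Delta> x (a, k) * ?\<Delta> (basis_vec a) (g, h) = of_bool (a = k) * (x k * of_bool (g = h \<and> h = k))"
      if "a \<in> ?M" for a
      using that by (auto simp: diag_coprod_apply basis_vec_apply)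
    then have eq: "(\<Sum>a\<in>?M. ?\<Delta> x (a, k) * ?\<Delta> (basis_vec a) (g, h))
        = (if k \<in> ?M then x k * of_bool (g = h \<and> h = k) else 0)"
      by (simp only: sum_of_bool_eq[OF fin] cong: sum.cong)
    show ?thesis by (simp only: tensor_assoc_def case_prod_conv tensor_map_id_right[OF fin] eq) auto
  qed
  have assoc_right: "tensor_map ?M ?M (\<lambda>v. v) ?\<Delta> (?\<Delta> x) (g, (h, k))
      = (if g = h \<and> h = k \<and> k \<in> ?M then x k else 0)" for x g h k
  proof -
    have "?\<Delta> x (g, a) * ?\<Delta> (basis_vec a) (h, k) = of_bool (g = a) * (x g * of_bool (g = h \<and> h = k))"
      if "a \<in> ?M" for a
      using that by (auto simp: diag_coprod_apply basis_vec_apply)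
    then have eq: "(\<Sum>a\<in>?M. ?\<Delta> x (g, a) * ?\<Delta> (basis_vec a) (h, k))
        = (if g \<in> ?M then x g * of_bool (g = h \<and> h = k) else 0)"
      by (simp only: sum_of_bool_eq[OF fin] cong: sum.cong)
    show ?thesis by (simp only: tensor_map_id_left[OF fin] eq) auto
  qed
  show "finite ?M" by (rule fin)
  show "bilinear_mult ?M (comp_mult C :: ('m \<Rightarrow> 'k) \<Rightarrow> _)"
    by (auto simp: bilinear_mult_def linear_map_def vecs_def comp_mult_apply comp_coeff_notin
        algebra_simps sum.distrib sum_distrib_left)
  show "?e \<in> vecs ?M"
    using Id_in by (auto simp: vecs_def comp_unit_apply)
  show "comp_mult C (comp_mult C x y) z = comp_mult C x (comp_mult C y z)" for x y z :: "'m \<Rightarrow> 'k"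
    by (rule comp_mult_assoc)
  show "comp_mult C ?e x = x" "comp_mult C x ?e = x" if "x \<in> vecs ?M" for x
    using that by (simp_all add: comp_unit_left comp_unit_right)
  show "linear_map ?M (?M \<times> ?M) ?\<Delta>"
    by (auto simp: linear_map_def vecs_def diag_coprod_apply fun_eq_iff)
  show "linear_form ?M (diag_counit C :: ('m \<Rightarrow> 'k) \<Rightarrow> _)"
    by (simp add: linear_form_def diag_counit_def sum.distrib sum_distrib_left)
  show "tensor_assoc (tensor_map ?M ?M ?\<Delta> (\<lambda>v. v) (?\<Delta> x)) = tensor_map ?M ?M (\<lambda>v. v) ?\<Delta> (?\<Delta> x)" for x
    using assoc_left assoc_right by (auto simp: fun_eq_iff)
  have expand: "(\<Sum>a\<in>?M. x a * (diag_counit C (basis_vec a) * basis_vec a p)) = x p"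
    if x: "x \<in> vecs ?M" for x :: "'m \<Rightarrow> 'k" and p
  proof -
    have "(\<Sum>a\<in>?M. x a * (diag_counit C (basis_vec a) * basis_vec a p))
        = (\<Sum>a\<in>?M. x a * of_bool (p = a))"
      by (intro sum.cong refl) (simp add: diag_counit_basis_vec basis_vec_apply)
    also have "\<dots> = x p"
      using x by (simp only: sum_of_bool_eq[OF fin]) (auto simp: vecs_def)
    finally show ?thesis .
  qed
  show "(\<lambda>p. \<Sum>(i, j)\<in>?M \<times> ?M. ?\<Delta> x (i, j) * diag_counit C (basis_vec i) * basis_vec j p) = x"
    if "x \<in> vecs ?M" for x
    unfolding mult.assoc sum_diag_coprod using that by (simp add: expand)
  show "(\<lambda>p. \<Sum>(i, j)\<in>?M \<times> ?M. ?\<Delta> x (i, j) * diag_counit C (basis_vec j) * basis_vec i p) = x"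
    if "x \<in> vecs ?M" for x
    unfolding mult.assoc sum_diag_coprod using that by (simp add: expand)
  show "?\<Delta> (comp_mult C x y) = tensor_mult ?M ?M (comp_mult C) (comp_mult C) (?\<Delta> x) (?\<Delta> y)" for x y
    by (rule tensor_mult_diag[symmetric])
  have supp: "{a, b, c} \<subseteq> Id C ` Obj C" if "tensor_assoc (tens (?\<Delta> ?e) ?e) (a, b, c) \<noteq> 0" for a b c
    using that by (auto simp: tensor_assoc_def tens_def diag_coprod_apply comp_unit_apply split: if_splits)
  have supp': "{a, b, c} \<subseteq> Id C ` Obj C" if "tens ?e (?\<Delta> ?e) (a, b, c) \<noteq> 0" for a b c
    using that by (auto simp: tens_def diag_coprod_apply comp_unit_apply split: if_splits)
  have prod: "(if p \<in> ?M \<times> ?M \<times> ?M then tensor_assoc (tens (?\<Delta> ?e) ?e) p * tens ?e (?\<Delta> ?e) p else 0)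
      = tensor_assoc (tensor_map ?M ?M ?\<Delta> (\<lambda>v. v) (?\<Delta> ?e)) p" for p
  proof -
    obtain g h k where p: "p = (g, h, k)" by (metis prod.collapse)
    show ?thesis
      unfolding p assoc_left
      by (auto simp: tensor_assoc_def tens_def diag_coprod_apply comp_unit_apply)
  qed
  show "tensor_mult ?M (?M \<times> ?M) (comp_mult C) ?\<nu> (tensor_assoc (tens (?\<Delta> ?e) ?e)) (tens ?e (?\<Delta> ?e))
         = tensor_assoc (tensor_map ?M ?M ?\<Delta> (\<lambda>v. v) (?\<Delta> ?e))"
    by (rule trans[OF tensor_mult_comp_3], erule supp, erule supp', rule ext, rule prod)
  show "tensor_mult ?M (?M \<times> ?M) (comp_mult C) ?\<nu> (tens ?e (?\<Delta> ?e)) (tensor_assoc (tens (?\<Delta> ?e) ?e))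
         = tensor_assoc (tensor_map ?M ?M ?\<Delta> (\<lambda>v. v) (?\<Delta> ?e))"
    by (rule trans[OF tensor_mult_comp_3], erule supp', erule supp, rule ext, subst mult.commute, rule prod)
  have triple: "diag_counit C (comp_mult C (comp_mult C x y) z)
      = (\<Sum>a\<in>?M. y a * ((\<Sum>g\<in>?M. x g * of_bool ((g, a) \<in> composable C)) *
          (\<Sum>k\<in>?M. z k * of_bool ((a, k) \<in> composable C))))" for x y z :: "'m \<Rightarrow> 'k"
  proof -
    let ?d = "\<lambda>g h. of_bool ((g, h) \<in> composable C) :: 'k"
    have coeff: "(\<Sum>p\<in>?M. comp_coeff g a p * ?d p k) = ?d g a * ?d a k" for g a k
      unfolding sum_comp_coeff by (auto simp: composable_Comp_left)
    have "diag_counit C (comp_mult C (comp_mult C x y) z)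
       = (\<Sum>p\<in>?M. \<Sum>k\<in>?M. \<Sum>g\<in>?M. \<Sum>a\<in>?M. x g * y a * z k * (comp_coeff g a p * ?d p k))"
      by (simp add: diag_counit_comp_mult comp_mult_apply[of x] sum_distrib_left sum_distrib_right mult_ac)
    also have "\<dots> = (\<Sum>k\<in>?M. \<Sum>g\<in>?M. \<Sum>a\<in>?M. \<Sum>p\<in>?M. x g * y a * z k * (comp_coeff g a p * ?d p k))"
      by (rule sum_rotate_4)
    also have "\<dots> = (\<Sum>k\<in>?M. \<Sum>g\<in>?M. \<Sum>a\<in>?M. x g * y a * z k * (?d g a * ?d a k))"
      by (simp only: sum_distrib_left[symmetric] coeff)
    also have "\<dots> = (\<Sum>a\<in>?M. \<Sum>g\<in>?M. \<Sum>k\<in>?M. x g * y a * z k * (?d g a * ?d a k))"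
      by (subst sum_rotate_3, rule sum.swap)
    finally show ?thesis unfolding sum_product by (simp add: sum_distrib_left mult_ac)
  qed
  have left: "diag_counit C (comp_mult C x (basis_vec a)) = (\<Sum>g\<in>?M. x g * of_bool ((g, a) \<in> composable C))"
    and right: "diag_counit C (comp_mult C (basis_vec a) x) = (\<Sum>k\<in>?M. x k * of_bool ((a, k) \<in> composable C))"
    if "a \<in> ?M" for x :: "'m \<Rightarrow> 'k" and a
  proof -
    have "diag_counit C (comp_mult C x (basis_vec a))
        = (\<Sum>g\<in>?M. \<Sum>h\<in>?M. of_bool (h = a) * (x g * of_bool ((g, h) \<in> composable C)))"
      unfolding diag_counit_comp_mult basis_vec_apply by (simp only: mult_ac)
    then show "diag_counit C (comp_mult C x (basis_vec a)) = (\<Sum>g\<in>?M. x g * of_bool ((g, a) \<in> composable C))"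
      using that by (simp only: sum_of_bool_eq[OF fin] if_True)
    have "diag_counit C (comp_mult C (basis_vec a) x)
        = (\<Sum>g\<in>?M. of_bool (g = a) * (\<Sum>h\<in>?M. x h * of_bool ((g, h) \<in> composable C)))"
      unfolding diag_counit_comp_mult basis_vec_apply by (simp only: mult_ac sum_distrib_left)
    then show "diag_counit C (comp_mult C (basis_vec a) x) = (\<Sum>k\<in>?M. x k * of_bool ((a, k) \<in> composable C))"
      using that by (simp only: sum_of_bool_eq[OF fin] if_True)
  qed
  show "diag_counit C (comp_mult C (comp_mult C x y) z) =
          (\<Sum>(a, b)\<in>?M \<times> ?M. ?\<Delta> y (a, b) * diag_counit C (comp_mult C x (basis_vec a)) *
             diag_counit C (comp_mult C (basis_vec b) z))" for x y z
    unfolding triple mult.assoc sum_diag_coprod by (simp add: left right)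
  show "diag_counit C (comp_mult C (comp_mult C x y) z) =
          (\<Sum>(a, b)\<in>?M \<times> ?M. ?\<Delta> y (a, b) * diag_counit C (comp_mult C x (basis_vec b)) *
             diag_counit C (comp_mult C (basis_vec a) z))" for x y z
    unfolding triple mult.assoc sum_diag_coprod by (simp add: left right)
qed

end

section \<open>Categories described by their arrows alone\<close>

text \<open>
  A category in single-sorted form: \<open>R g h f\<close> means that \<open>g \<circ> h\<close> is defined
  and equal to \<open>f\<close>, and \<open>E\<close> consists of the identities. Sources and targets are
  not part of the data. The unit axioms take the form in which the weak bialgebra axioms
  deliver them: each arrow has some left and some right unit, while the uniqueness of these units and
  the law \<open>i \<circ> f = f\<close> for every defined composite with \<open>i \<in> E\<close>
  are consequences of associativity and of the discreteness of \<open>E\<close>.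
\<close>

locale arrows_only_category =
  fixes I :: "'a set" and E :: "'a set" and R :: "'a \<Rightarrow> 'a \<Rightarrow> 'a \<Rightarrow> bool"
  assumes R_closed: "R g h f \<Longrightarrow> g \<in> I \<and> h \<in> I \<and> f \<in> I"
    and R_functional: "R g h f \<Longrightarrow> R g h f' \<Longrightarrow> f = f'"
    and R_assoc: "(\<exists>a. R g h a \<and> R a k f) \<longleftrightarrow> (\<exists>b. R h k b \<and> R g b f)"
    and R_local: "R g h a \<Longrightarrow> R h k b \<Longrightarrow> \<exists>f. R a k f"
    and E_subset: "E \<subseteq> I"
    and E_idem: "i \<in> E \<Longrightarrow> R i i i"
    and E_discrete: "i \<in> E \<Longrightarrow> j \<in> E \<Longrightarrow> R i j f \<Longrightarrow> i = j"
    and unit_left_ex: "f \<in> I \<Longrightarrow> \<exists>i\<in>E. R i f f"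
    and unit_right_ex: "f \<in> I \<Longrightarrow> \<exists>i\<in>E. R f i f"
begin

text \<open>
  If \<open>u \<circ> f = f\<close> and \<open>i \<circ> f\<close> is defined, then
  \<open>i \<circ> (u \<circ> f)\<close> is defined, hence so is \<open>i \<circ> u\<close>; distinct elements
  of \<open>E\<close> do not compose.
\<close>

lemma left_unit_unique:
  assumes "i \<in> E" "R i f g" "u \<in> E" "R u f f"
  shows "i = u"
proof -
  have "\<exists>b. R u f b \<and> R i b g" using assms by blast
  then obtain a where "R i u a" using R_assoc by blast
  then show ?thesis using E_discrete assms by blast
qed

lemma right_unit_unique:
  assumes "i \<in> E" "R f i g" "u \<in> E" "R f u f"
  shows "i = u"
proof -
  have "\<exists>a. R f u a \<and> R a i g" using assms by blast
  then obtain b where "R u i b" using R_assoc by blast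
  then show ?thesis using E_discrete assms by blast
qed

definition src :: "'a \<Rightarrow> 'a" where "src f = (THE i. i \<in> E \<and> R f i f)"
definition tgt :: "'a \<Rightarrow> 'a" where "tgt f = (THE i. i \<in> E \<and> R i f f)"

lemma src: assumes "f \<in> I" shows "src f \<in> E" "R f (src f) f"
proof -
  have "\<exists>!i. i \<in> E \<and> R f i f" using unit_right_ex[OF assms] right_unit_unique by blast
  from theI'[OF this] show "src f \<in> E" "R f (src f) f" unfolding src_def by auto
qed

lemma tgt: assumes "f \<in> I" shows "tgt f \<in> E" "R (tgt f) f f"
proof -
  have "\<exists>!i. i \<in> E \<and> R i f f" using unit_left_ex[OF assms] left_unit_unique by blast
  from theI'[OF this] show "tgt f \<in> E" "R (tgt f) f f" unfolding tgt_def by auto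
qed

lemma src_eqI: "i \<in> E \<Longrightarrow> R f i g \<Longrightarrow> src f = i"
  using right_unit_unique src R_closed by metis

lemma tgt_eqI: "i \<in> E \<Longrightarrow> R i f g \<Longrightarrow> tgt f = i"
  using left_unit_unique tgt R_closed by metis

text \<open>
  This is where the locality axiom is needed. If \<open>u\<close> is both the source of \<open>g\<close>
  and the target of \<open>h\<close>, then \<open>g \<circ> u = g\<close> and \<open>u \<circ> h = h\<close> are
  defined, and locality makes \<open>(g \<circ> u) \<circ> h\<close> defined.
\<close>

lemma R_exists_iff:
  assumes "g \<in> I" "h \<in> I"
  shows "(\<exists>f. R g h f) \<longleftrightarrow> src g = tgt h"
proof
  assume "\<exists>f. R g h f"
  then obtain f where "R g h f" ..
  then have "\<exists>a. R g (src g) a \<and> R a h f" using src assms by blast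
  then obtain b where "R (src g) h b" using R_assoc by blast
  then show "src g = tgt h" using tgt_eqI src assms by metis
next
  assume "src g = tgt h"
  then have "R g (src g) g" "R (src g) h h" using src tgt assms by metis+
  then show "\<exists>f. R g h f" using R_local by blast
qed

lemma src_composite: assumes "R g h f" shows "src f = src h"
proof -
  have h: "h \<in> I" using R_closed assms by blast
  then have "\<exists>b. R h (src h) b \<and> R g b f" using assms src by blast
  then obtain a where "R g h a" "R a (src h) f" using R_assoc by blast
  then have "R f (src h) f" using R_functional assms by blast
  then show ?thesis using src_eqI src h by blast
qed

lemma tgt_composite: assumes "R g h f" shows "tgt f = tgt g"
proof -
  have g: "g \<in> I" using R_closed assms by blast
  then have "\<exists>a. R (tgt g) g a \<and> R a h f" using assms tgt by blast
  then obtain b where "R g h b" "R (tgt g) b f" using R_assoc by blast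
  then have "R (tgt g) f f" using R_functional assms by blast
  then show ?thesis using tgt_eqI tgt g by blast
qed

definition arrow_category :: "('a, 'a) category" where
  "arrow_category = \<lparr>Obj = E, Mor = I, Src = restrict src I, Tgt = restrict tgt I,
     Id = restrict (\<lambda>x. x) E,
     Comp = restrict (\<lambda>(g, h). THE f. R g h f) {(g, h). g \<in> I \<and> h \<in> I \<and> src g = tgt h}\<rparr>"

lemma arrow_category_simps [simp]:
  "Obj arrow_category = E" "Mor arrow_category = I"
  "f \<in> I \<Longrightarrow> Src arrow_category f = src f" "f \<in> I \<Longrightarrow> Tgt arrow_category f = tgt f"
  "x \<in> E \<Longrightarrow> Id arrow_category x = x"
  by (simp_all add: arrow_category_def)

lemma composable_arrow_category:
  "(g, h) \<in> composable arrow_category \<longleftrightarrow> g \<in> I \<and> h \<in> I \<and> src g = tgt h"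
  by (auto simp: composable_def)

lemma Comp_arrow_category:
  assumes "R g h f"
  shows "(g, h) \<in> composable arrow_category" and "Comp arrow_category (g, h) = f"
proof -
  have *: "g \<in> I" "h \<in> I" "src g = tgt h" using assms R_closed R_exists_iff by blast+
  then show "(g, h) \<in> composable arrow_category" by (simp add: composable_arrow_category)
  have "(THE f. R g h f) = f" using assms R_functional by blast
  then show "Comp arrow_category (g, h) = f" using * by (simp add: arrow_category_def)
qed

lemma composable_arrow_categoryE:
  assumes "(g, h) \<in> composable arrow_category"
  obtains f where "R g h f" "Comp arrow_category (g, h) = f"
  using assms R_exists_iff Comp_arrow_category composable_arrow_category by metis

lemma decompositions_arrow_category: "(g, h) \<in> decompositions arrow_category f \<longleftrightarrow> R g h f"
  by (auto simp: decompositions_def intro: Comp_arrow_category elim: composable_arrow_categoryE)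

lemma small_category_arrow_category: "small_category arrow_category"
proof
  let ?C = arrow_category
  show "Src ?C \<in> Mor ?C \<rightarrow>\<^sub>E Obj ?C" "Tgt ?C \<in> Mor ?C \<rightarrow>\<^sub>E Obj ?C" "Id ?C \<in> Obj ?C \<rightarrow>\<^sub>E Mor ?C"
    using E_subset by (auto simp: arrow_category_def src tgt)
  have "Comp ?C \<in> extensional (composable ?C)"
    by (auto simp: arrow_category_def composable_def extensional_def)
  then show "Comp ?C \<in> composable ?C \<rightarrow>\<^sub>E Mor ?C"
    using R_closed by (auto simp: PiE_iff elim!: composable_arrow_categoryE)
  show "Src ?C (Id ?C x) = x" "Tgt ?C (Id ?C x) = x" if "x \<in> Obj ?C" for x
  proof -
    have "x \<in> E" "x \<in> I" "R x x x" using that E_subset E_idem by auto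
    then show "Src ?C (Id ?C x) = x" "Tgt ?C (Id ?C x) = x"
      using src_eqI[of x x x] tgt_eqI[of x x x] by simp_all
  qed
  show "Src ?C (Comp ?C (g, h)) = Src ?C h" if "(g, h) \<in> composable ?C" for g h
    using that R_closed src_composite by (elim composable_arrow_categoryE) auto
  show "Tgt ?C (Comp ?C (g, h)) = Tgt ?C g" if "(g, h) \<in> composable ?C" for g h
    using that R_closed tgt_composite by (elim composable_arrow_categoryE) auto
  show "Comp ?C (Id ?C (Tgt ?C f), f) = f" "Comp ?C (f, Id ?C (Src ?C f)) = f" if "f \<in> Mor ?C" for f
    using that src tgt by (auto intro: Comp_arrow_category)
  show "Comp ?C (Comp ?C (f, g), h) = Comp ?C (f, Comp ?C (g, h))"
    if fg: "(f, g) \<in> composable ?C" and gh: "(g, h) \<in> composable ?C" for f g h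
  proof -
    obtain a where a: "R f g a" using fg by (blast elim: composable_arrow_categoryE)
    obtain b where b: "R g h b" using gh by (blast elim: composable_arrow_categoryE)
    then obtain r where r: "R a h r" using R_local a by blast
    then obtain b' where "R g h b'" "R f b' r" using R_assoc a by blast
    then have "R f b r" using R_functional b by blast
    then show ?thesis using a b r by (simp add: Comp_arrow_category)
  qed
qed

end

section \<open>The category of a weak bialgebra with pointwise product\<close>

locale pointwise_weak_bialgebra =
  weak_bialgebra_on I pointwise_mult "pointwise_unit I" \<Delta> \<epsilon>
  for I :: "'a set" and \<Delta> :: "('a \<Rightarrow> 'k::field) \<Rightarrow> ('a \<times> 'a \<Rightarrow> 'k)" and \<epsilon> :: "('a \<Rightarrow> 'k) \<Rightarrow> 'k"
begin

definition composite :: "'a \<Rightarrow> 'a \<Rightarrow> 'a \<Rightarrow> bool" where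
  "composite g h f \<longleftrightarrow> f \<in> I \<and> \<Delta> (basis_vec f) (g, h) = 1"

definition units :: "'a set" where
  "units = {i \<in> I. \<epsilon> (basis_vec i) = 1}"

lemma comult_in: "f \<in> I \<Longrightarrow> \<Delta> (basis_vec f) \<in> vecs (I \<times> I)"
  using comult_linear by (auto simp: linear_map_def)

lemma comult_apply: "v \<in> vecs I \<Longrightarrow> \<Delta> v p = (\<Sum>f\<in>I. v f * \<Delta> (basis_vec f) p)"
  by (rule linear_map_apply_eq_sum[OF finite_basis comult_linear])

lemma counit_apply: "v \<in> vecs I \<Longrightarrow> \<epsilon> v = (\<Sum>f\<in>I. v f * \<epsilon> (basis_vec f))"
  by (rule linear_form_eq_sum[OF finite_basis counit_linear])

lemma zero_in_vecs: "(\<lambda>_. 0) \<in> vecs I"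
  by (simp add: vecs_def)

lemma pointwise_mult_basis_vec:
  "pointwise_mult (basis_vec f) (basis_vec g) = (if f = g then basis_vec f else (\<lambda>_. 0))"
  by (auto simp: pointwise_mult_def basis_vec_def)

lemma comult_zero: "\<Delta> (\<lambda>_. 0) = (\<lambda>_. 0)"
  using comult_apply[OF zero_in_vecs] by auto

lemma counit_zero: "\<epsilon> (\<lambda>_. 0) = 0"
  using counit_apply[OF zero_in_vecs] by simp

text \<open>
  Multiplicativity turns the orthogonal idempotents \<open>e\<^sub>f\<close> into orthogonal idempotents
  of the tensor square. For a fixed coordinate \<open>p\<close> the coefficients are thus orthogonal
  idempotents of the field: all are 0 or 1, and at most one of them is 1. This makes the coproduct
  the graph of a partial binary operation.
\<close>

lemma comult_basis_mult:
  assumes "f \<in> I" "f' \<in> I"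
  shows "\<Delta> (basis_vec f) p * \<Delta> (basis_vec f') p = (if f = f' then \<Delta> (basis_vec f) p else 0)"
proof -
  have "\<Delta> (pointwise_mult (basis_vec f) (basis_vec f')) p
      = (if p \<in> I \<times> I then \<Delta> (basis_vec f) p * \<Delta> (basis_vec f') p else 0)"
    using comult_mult[of "basis_vec f" "basis_vec f'"] assms
    by (simp add: tensor_mult_pointwise_2[OF finite_basis])
  moreover have "\<Delta> (basis_vec f) p = 0" if "p \<notin> I \<times> I"
    using that comult_in[OF assms(1)] by (cases p) (simp add: vecs_def)
  ultimately show ?thesis
    by (auto simp: pointwise_mult_basis_vec comult_zero split: if_splits)
qed

lemma comult_basis: "f \<in> I \<Longrightarrow> \<Delta> (basis_vec f) (g, h) = of_bool (composite g h f)"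
  using comult_basis_mult[of f f "(g, h)"] by (auto simp: composite_def)

lemma composite_closed: "composite g h f \<Longrightarrow> g \<in> I \<and> h \<in> I \<and> f \<in> I"
proof -
  assume fac: "composite g h f"
  then have "\<Delta> (basis_vec f) (g, h) \<noteq> 0" "f \<in> I" by (simp_all add: composite_def)
  moreover have "\<Delta> (basis_vec f) (g, h) = 0" if "(g, h) \<notin> I \<times> I"
    using comult_in[OF \<open>f \<in> I\<close>] that unfolding vecs_def by blast
  ultimately show ?thesis by blast
qed

lemma composite_functional: "composite g h f \<Longrightarrow> composite g h f' \<Longrightarrow> f = f'"
  using comult_basis_mult[of f f' "(g, h)"] by (auto simp: composite_def split: if_splits)

text \<open>
  The unit is the sum of all \<open>e\<^sub>f\<close>, and a pair has at most one composite. So the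
  weak unit axioms, being about this tensor, constrain where the operation is defined.
\<close>

lemma comult_unit: "\<Delta> (pointwise_unit I) (g, h) = of_bool (\<exists>f. composite g h f)"
proof -
  have "\<Delta> (pointwise_unit I) (g, h) = (\<Sum>f\<in>I. of_bool (composite g h f))"
    by (subst comult_apply[OF unit_closed])
       (simp add: pointwise_unit_apply finite_basis comult_basis)
  also have "\<dots> = of_bool (\<exists>f. composite g h f)"
    using composite_closed composite_functional by (intro sum_of_bool_unique[OF finite_basis]) blast+
  finally show ?thesis .
qed

text \<open>
  The coordinates of the two sides of coassociativity are sums of 0s and 1s with at most one
  nonzero term, by functionality. Hence they can be compared as truth values in any characteristic.
\<close>

lemma composite_assoc:
  "(\<exists>a. composite g h a \<and> composite a k f) \<longleftrightarrow> (\<exists>b. composite h k b \<and> composite g b f)"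
proof (cases "f \<in> I \<and> g \<in> I \<and> k \<in> I")
  case True
  have "(\<Sum>a\<in>I. of_bool (composite g h a \<and> composite a k f)) =
      (\<Sum>b\<in>I. (of_bool (composite h k b \<and> composite g b f) :: 'k))"
    using fun_cong[OF comult_coassoc[of "basis_vec f"], of "(g, (h, k))"] True
    by (simp add: tensor_assoc_def tensor_map_id_left[OF finite_basis]
        tensor_map_id_right[OF finite_basis] comult_basis of_bool_conj mult.commute)
  also have "(\<Sum>b\<in>I. (of_bool (composite h k b \<and> composite g b f) :: 'k))
      = of_bool (\<exists>b. composite h k b \<and> composite g b f)"
    using composite_closed composite_functional by (intro sum_of_bool_unique[OF finite_basis]) blast+
  also have "(\<Sum>a\<in>I. (of_bool (composite g h a \<and> composite a k f) :: 'k))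
      = of_bool (\<exists>a. composite g h a \<and> composite a k f)"
    using composite_closed composite_functional by (intro sum_of_bool_unique[OF finite_basis]) blast+
  finally show ?thesis by (simp only: of_bool_eq_iff)
qed (use composite_closed in blast)

text \<open>
  The first weak unit axiom at the coordinate \<open>(g, h, k)\<close>: the left-hand side is 1 when
  both inner pairs compose, and the right-hand side vanishes unless \<open>(g \<circ> h) \<circ> k\<close>
  is defined.
\<close>

lemma composite_local:
  assumes "composite g h a" "composite h k b"
  shows "\<exists>f. composite a k f"
proof -
  have mem: "g \<in> I" "h \<in> I" "k \<in> I" using assms composite_closed by blast+
  have "of_bool (\<exists>f. composite g h f) * of_bool (\<exists>f. composite h k f)
      = (\<Sum>a\<in>I. of_bool (\<exists>f. composite a k f) * (of_bool (composite g h a) :: 'k))"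
    using fun_cong[OF weak_comult_unit_1, of "(g, (h, k))"] mem
    unfolding tensor_mult_pointwise_3[OF finite_basis]
    by (auto simp: tensor_assoc_def tens_def tensor_map_id_right[OF finite_basis] comult_unit
        comult_basis pointwise_unit_apply[OF finite_basis])
  moreover have "\<exists>f. composite g h f" "\<exists>f. composite h k f" using assms by blast+
  ultimately have "(\<Sum>a\<in>I. of_bool (\<exists>f. composite a k f) * of_bool (composite g h a)) = (1 :: 'k)"
    by simp
  then obtain a' where "of_bool (\<exists>f. composite a' k f) * of_bool (composite g h a') \<noteq> (0 :: 'k)"
    by (metis (no_types, lifting) sum.neutral zero_neq_one)
  then have "composite g h a'" "\<exists>f. composite a' k f" by (auto split: if_splits)
  then show ?thesis using composite_functional assms by blast
qed

text \<open>
  The weak counit axiom at basis vectors is what makes the counit discrete. For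
  \<open>i = f = j\<close> it forces \<open>\<epsilon>(e\<^sub>i)\<close> to be 0 or 1, with
  \<open>i \<circ> i = i\<close> in the second case; for the other triples it forbids composites of
  distinct units.
\<close>

lemma weak_counit_basis:
  assumes "i \<in> I" "f \<in> I" "j \<in> I"
  shows "(if i = f \<and> f = j then \<epsilon> (basis_vec f) else 0)
     = of_bool (composite i j f) * \<epsilon> (basis_vec i) * \<epsilon> (basis_vec j)"
proof -
  have eps: "\<epsilon> (pointwise_mult (basis_vec a) (basis_vec b)) = of_bool (a = b) * \<epsilon> (basis_vec a)" for a b
    by (simp add: pointwise_mult_basis_vec counit_zero)
  have "(if i = f \<and> f = j then \<epsilon> (basis_vec f) else 0)
      = \<epsilon> (pointwise_mult (pointwise_mult (basis_vec i) (basis_vec f)) (basis_vec j))"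
    by (auto simp: pointwise_mult_basis_vec counit_zero) (auto simp: pointwise_mult_def counit_zero)
  also have "\<dots> = (\<Sum>(a, b)\<in>I \<times> I. \<Delta> (basis_vec f) (a, b) * (of_bool (i = a) * \<epsilon> (basis_vec i))
       * (of_bool (b = j) * \<epsilon> (basis_vec b)))"
    using assms by (subst weak_counit_mult_1) (simp_all add: eps)
  also have "\<dots> = (\<Sum>a\<in>I. of_bool (i = a) * (\<Sum>b\<in>I. of_bool (b = j) *
       (\<Delta> (basis_vec f) (a, b) * \<epsilon> (basis_vec i) * \<epsilon> (basis_vec b))))"
    unfolding sum_distrib_left sum.cartesian_product by (intro sum.cong refl) (auto simp: mult_ac)
  also have "\<dots> = \<Delta> (basis_vec f) (i, j) * \<epsilon> (basis_vec i) * \<epsilon> (basis_vec j)"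
    using assms by (simp only: sum_of_bool_eq[OF finite_basis] if_True)
  finally show ?thesis using assms by (simp add: comult_basis)
qed

lemma counit_basis: "i \<in> I \<Longrightarrow> \<epsilon> (basis_vec i) = of_bool (i \<in> units)"
proof -
  assume i: "i \<in> I"
  have "\<epsilon> (basis_vec i) = 0 \<or> of_bool (composite i i i) * \<epsilon> (basis_vec i) = 1"
    using weak_counit_basis[of i i i] i by auto
  then have "\<epsilon> (basis_vec i) = 0 \<or> \<epsilon> (basis_vec i) = 1" by (auto simp: of_bool_def split: if_splits)
  then show ?thesis using i by (auto simp: units_def)
qed

lemma units_idem: "i \<in> units \<Longrightarrow> composite i i i"
  using weak_counit_basis[of i i i] by (auto simp: units_def split: if_splits)

lemma units_discrete: "i \<in> units \<Longrightarrow> j \<in> units \<Longrightarrow> composite i j f \<Longrightarrow> i = j"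
  using weak_counit_basis[of i f j] composite_closed[of i j f]
  by (auto simp: units_def split: if_splits)

text \<open>
  The counit law only determines, as an element of the field, the number of units \<open>i\<close>
  with \<open>i \<circ> f = f\<close>. In positive characteristic this does not bound their
  number, but the value 1 does show that there is at least one.
\<close>

lemma left_unit_exists: assumes "f \<in> I" shows "\<exists>i\<in>units. composite i f f"
proof -
  have "(\<Sum>i\<in>I. \<Delta> (basis_vec f) (i, f) * \<epsilon> (basis_vec i)) = 1"
    using fun_cong[OF counit_left[of "basis_vec f"], of f] assms
    by (simp add: sum_basis_vec_fst[OF finite_basis] basis_vec_apply[of f f])
  then obtain i where "i \<in> I" "\<Delta> (basis_vec f) (i, f) * \<epsilon> (basis_vec i) \<noteq> 0"
    by (metis (no_types, lifting) sum.neutral zero_neq_one)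
  then show ?thesis using assms by (auto simp: comult_basis counit_basis)
qed

lemma right_unit_exists: assumes "f \<in> I" shows "\<exists>i\<in>units. composite f i f"
proof -
  have "(\<Sum>i\<in>I. \<Delta> (basis_vec f) (f, i) * \<epsilon> (basis_vec i)) = 1"
    using fun_cong[OF counit_right[of "basis_vec f"], of f] assms
    by (simp add: sum_basis_vec_snd[OF finite_basis] basis_vec_apply[of f f])
  then obtain i where "i \<in> I" "\<Delta> (basis_vec f) (f, i) * \<epsilon> (basis_vec i) \<noteq> 0"
    by (metis (no_types, lifting) sum.neutral zero_neq_one)
  then show ?thesis using assms by (auto simp: comult_basis counit_basis)
qed

sublocale arrows_only_category I units composite
proof
  show "composite g h f \<Longrightarrow> g \<in> I \<and> h \<in> I \<and> f \<in> I" for g h f by (rule composite_closed)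
  show "units \<subseteq> I" by (auto simp: units_def)
qed (fact composite_functional composite_assoc composite_local units_idem units_discrete
    left_unit_exists right_unit_exists)+

sublocale arrow: finite_category arrow_category
  using small_category_arrow_category finite_basis
  by (simp add: finite_category_def finite_category_axioms_def)

text \<open>
  The weak bialgebra is recovered from its category: both coproducts are linear and agree
  on basis vectors.
\<close>

lemma coprod_arrow_category: assumes "v \<in> vecs I" shows "coprod arrow_category v = \<Delta> v"
proof
  fix p :: "'a \<times> 'a"
  obtain g h where p: "p = (g, h)" by (cases p)
  interpret W: weak_bialgebra_on I pointwise_mult "pointwise_unit I"
    "coprod arrow_category :: ('a \<Rightarrow> 'k) \<Rightarrow> _" "counit arrow_category"
    using arrow.coprod_weak_bialgebra by simp
  have "coprod arrow_category v p = (\<Sum>f\<in>I. v f * coprod arrow_category (basis_vec f) p)"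
    by (rule linear_map_apply_eq_sum[OF finite_basis W.comult_linear assms])
  also have "\<dots> = (\<Sum>f\<in>I. v f * \<Delta> (basis_vec f) p)"
    using decompositions_arrow_category
    by (intro sum.cong refl) (auto simp: p arrow.coprod_apply comult_basis basis_vec_apply decompositions_def)
  also have "\<dots> = \<Delta> v p" by (rule comult_apply[OF assms, symmetric])
  finally show "coprod arrow_category v p = \<Delta> v p" .
qed

lemma counit_arrow_category: assumes "v \<in> vecs I" shows "counit arrow_category v = \<epsilon> v"
proof -
  have Id: "Id arrow_category ` units = units"
    using image_cong[of units units "Id arrow_category" "\<lambda>x. x"] by simp
  have "counit arrow_category v = (\<Sum>f\<in>I. v f * \<epsilon> (basis_vec f))"
    unfolding counit_def arrow_category_simps Id by (intro sum.cong refl) (simp add: counit_basis)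
  also have "\<dots> = \<epsilon> v" by (rule counit_apply[OF assms, symmetric])
  finally show ?thesis .
qed

end

section \<open>The bijection between labelled categories and weak bialgebras\<close>

lemma finite_category_labelled: "C \<in> labelled_categories n \<Longrightarrow> finite_category C"
  by (simp add: labelled_categories_def finite_category_def finite_category_axioms_def)

text \<open>
  When objects are their own identity morphisms, sources and targets are determined by composition:
  the target of \<open>f\<close> is the only object composable with \<open>f\<close> on the left.
\<close>

lemma labelled_category_eqI:
  assumes C: "C \<in> labelled_categories n" and D: "D \<in> labelled_categories n"
    and obj: "Obj C = Obj D" and dec: "\<And>f. f \<in> {1..n} \<Longrightarrow> decompositions C f = decompositions D f"
  shows "C = D"
proof -
  interpret C: finite_category C by (rule finite_category_labelled[OF C])
  interpret D: finite_category D by (rule finite_category_labelled[OF D])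
  have Mor: "Mor C = {1..n}" "Mor D = {1..n}"
    and Id: "\<And>x. x \<in> Obj C \<Longrightarrow> Id C x = x" "\<And>x. x \<in> Obj D \<Longrightarrow> Id D x = x"
    using C D by (auto simp: labelled_categories_def)
  have comp: "(g, h) \<in> composable C \<and> Comp C (g, h) = f \<longleftrightarrow> (g, h) \<in> composable D \<and> Comp D (g, h) = f"
    for g h f
  proof (cases "f \<in> {1..n}")
    case True
    then show ?thesis using dec[OF True] by (auto simp: decompositions_def set_eq_iff)
  next
    case False
    then show ?thesis using C.Comp_in D.Comp_in Mor by metis
  qed
  have composable: "composable C = composable D"
    using comp by (auto simp: set_eq_iff)
  have "Src C f = Src D f" if f: "f \<in> {1..n}" for f
  proof -
    have x: "Src C f \<in> Obj C" using f Mor C.Src_in by auto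
    have "(f, Src C f) \<in> composable C" using C.composable_Id_right[OF x, of f] f Mor Id x by simp
    then show ?thesis
      using D.composable_Id_right[of "Src C f" f] x Id obj composable by simp
  qed
  then have Src: "Src C = Src D"
    using C.Src_closed D.Src_closed Mor obj
    by (intro PiE_ext[of "Src C" "{1..n}" "\<lambda>_. Obj C"]) simp_all
  have "Tgt C f = Tgt D f" if f: "f \<in> {1..n}" for f
  proof -
    have x: "Tgt C f \<in> Obj C" using f Mor C.Tgt_in by auto
    have "(Tgt C f, f) \<in> composable C" using C.composable_Id_left[OF x, of f] f Mor Id x by simp
    then show ?thesis
      using D.composable_Id_left[of "Tgt C f" f] x Id obj composable by simp
  qed
  then have Tgt: "Tgt C = Tgt D"
    using C.Tgt_closed D.Tgt_closed Mor obj
    by (intro PiE_ext[of "Tgt C" "{1..n}" "\<lambda>_. Obj C"]) simp_all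
  have IdCD: "Id C = Id D"
    using C.Id_closed D.Id_closed Id Mor obj
    by (intro PiE_ext[of "Id C" "Obj C" "\<lambda>_. {1..n}"]) simp_all
  have "Comp C = Comp D"
  proof (rule PiE_ext)
    show "Comp C \<in> composable C \<rightarrow>\<^sub>E Mor C" by (rule C.Comp_closed)
    show "Comp D \<in> composable C \<rightarrow>\<^sub>E Mor C" using D.Comp_closed by (simp add: composable Mor)
    fix p assume "p \<in> composable C"
    then show "Comp C p = Comp D p" using comp by (cases p) blast
  qed
  then show ?thesis using obj Mor Src Tgt IdCD by simp
qed

definition category_wbs ::
    "nat \<Rightarrow> (nat, nat) category \<Rightarrow>
       ((nat \<Rightarrow> 'k::field) \<Rightarrow> (nat \<times> nat \<Rightarrow> 'k)) \<times> ((nat \<Rightarrow> 'k) \<Rightarrow> 'k)" where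
  "category_wbs n C = (restrict (coprod C) (vecs {1..n}), restrict (counit C) (vecs {1..n}))"

lemma category_wbs_in:
  assumes C: "C \<in> labelled_categories n"
  shows "category_wbs n C \<in> (pointwise_wbs n :: (((nat \<Rightarrow> 'k::field) \<Rightarrow> _) \<times> _) set)"
proof -
  interpret finite_category C by (rule finite_category_labelled[OF C])
  have "Mor C = {1..n}" using C by (simp add: labelled_categories_def)
  then have "weak_bialgebra_on {1..n} pointwise_mult (pointwise_unit {1..n})
      (coprod C :: (nat \<Rightarrow> 'k) \<Rightarrow> _) (counit C)"
    using coprod_weak_bialgebra by simp
  then have "weak_bialgebra_on {1..n} pointwise_mult (pointwise_unit {1..n})
      (restrict (coprod C :: (nat \<Rightarrow> 'k) \<Rightarrow> _) (vecs {1..n})) (restrict (counit C) (vecs {1..n}))"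
    by (rule weak_bialgebra_on_cong) simp_all
  then show ?thesis by (simp add: pointwise_wbs_def category_wbs_def)
qed

text \<open>
  The objects are read off from the counit and the factorisations from the coproduct, because 0 and
  1 are distinct in the field.
\<close>

lemma category_wbs_inj: "inj_on (category_wbs n :: _ \<Rightarrow> ((nat \<Rightarrow> 'k::field) \<Rightarrow> _) \<times> _) (labelled_categories n)"
proof (rule inj_onI)
  fix C D :: "(nat, nat) category"
  assume C: "C \<in> labelled_categories n" and D: "D \<in> labelled_categories n"
    and eq: "category_wbs n C = (category_wbs n D :: ((nat \<Rightarrow> 'k) \<Rightarrow> _) \<times> _)"
  interpret C: finite_category C by (rule finite_category_labelled[OF C])
  interpret D: finite_category D by (rule finite_category_labelled[OF D])
  have coprod: "coprod C (v :: nat \<Rightarrow> 'k) = coprod D v" and counit: "counit C v = counit D v"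
    if "v \<in> vecs {1..n}" for v
  proof -
    have "restrict (coprod C :: (nat \<Rightarrow> 'k) \<Rightarrow> _) (vecs {1..n}) v = restrict (coprod D) (vecs {1..n}) v"
      "restrict (counit C) (vecs {1..n}) v = restrict (counit D) (vecs {1..n}) v"
      using eq by (simp_all add: category_wbs_def)
    then show "coprod C v = coprod D v" "counit C v = counit D v" using that by simp_all
  qed
  have Mor: "Mor C = {1..n}" "Mor D = {1..n}"
    and sub: "Obj C \<subseteq> {1..n}" "Obj D \<subseteq> {1..n}"
    and Id: "Id C ` Obj C = Obj C" "Id D ` Obj D = Obj D"
    using C D by (auto simp: labelled_categories_def)
  have "i \<in> Obj C \<longleftrightarrow> i \<in> Obj D" if i: "i \<in> {1..n}" for i
  proof -
    have "(of_bool (i \<in> Obj C) :: 'k) = of_bool (i \<in> Obj D)"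
      using counit[of "basis_vec i"] C.counit_basis_vec[of i, where 'k = 'k]
        D.counit_basis_vec[of i, where 'k = 'k] i Mor Id by simp
    then show ?thesis by (simp only: of_bool_eq_iff)
  qed
  then have obj: "Obj C = Obj D" using sub by blast
  have "decompositions C f = decompositions D f" if f: "f \<in> {1..n}" for f
  proof -
    have "(g, h) \<in> decompositions C f \<longleftrightarrow> (g, h) \<in> decompositions D f" for g h
      using fun_cong[OF coprod[of "basis_vec f"], of "(g, h)"] f
      by (auto simp: C.coprod_apply D.coprod_apply basis_vec_apply decompositions_def split: if_splits)
    then show ?thesis by auto
  qed
  then show "C = D" by (rule labelled_category_eqI[OF C D obj])
qed

lemma category_wbs_surj:
  assumes S: "S \<in> pointwise_wbs n"
  shows "\<exists>C\<in>labelled_categories n. category_wbs n C = S"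
proof -
  obtain \<Delta> \<epsilon> where S_eq: "S = (\<Delta>, \<epsilon>)" by (cases S)
  have W: "weak_bialgebra_on {1..n} pointwise_mult (pointwise_unit {1..n}) \<Delta> \<epsilon>"
    and ext: "\<Delta> \<in> extensional (vecs {1..n})" "\<epsilon> \<in> extensional (vecs {1..n})"
    using S by (auto simp: S_eq pointwise_wbs_def)
  interpret pointwise_weak_bialgebra "{1..n}" \<Delta> \<epsilon>
    using W by (simp add: pointwise_weak_bialgebra_def)
  have "restrict (coprod arrow_category) (vecs {1..n}) = \<Delta>"
    using coprod_arrow_category
    by (intro extensionalityI[OF restrict_extensional ext(1)]) (simp only: restrict_apply')
  moreover have "restrict (counit arrow_category) (vecs {1..n}) = \<epsilon>"
    using counit_arrow_category
    by (intro extensionalityI[OF restrict_extensional ext(2)]) (simp only: restrict_apply')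
  ultimately have "category_wbs n arrow_category = S"
    by (simp only: S_eq category_wbs_def)
  moreover have "arrow_category \<in> labelled_categories n"
    unfolding labelled_categories_def mem_Collect_eq arrow_category_simps
    using small_category_arrow_category E_subset by (intro conjI ballI refl arrow_category_simps)
  ultimately show ?thesis by blast
qed

lemma bij_betw_category_wbs: "bij_betw (category_wbs n) (labelled_categories n) (pointwise_wbs n)"
  using category_wbs_inj category_wbs_in category_wbs_surj
  unfolding bij_betw_def by blast

section \<open>Relabelling the morphisms of a category\<close>

text \<open>
  An isomorphism reflects composability, because its object map is injective. The factorisations are
  thus pulled back along the morphism map \<open>b\<close> alone. Together with the analogous statement
  on objects this shows that \<open>b\<close> determines the labelled category.
\<close>

lemma category_iso_decompositions:
  assumes "finite_category C" "finite_category D" and iso: "category_iso D C \<phi> b"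
    and f: "f \<in> Mor D"
  shows "decompositions D f = {(g, h). g \<in> Mor D \<and> h \<in> Mor D \<and> (b g, b h) \<in> decompositions C (b f)}"
proof -
  interpret C: finite_category C by fact
  interpret D: finite_category D by fact
  have \<phi>: "inj_on \<phi> (Obj D)" and b: "inj_on b (Mor D)" "b ` Mor D = Mor C"
    and st: "\<And>f. f \<in> Mor D \<Longrightarrow> Src C (b f) = \<phi> (Src D f)" "\<And>f. f \<in> Mor D \<Longrightarrow> Tgt C (b f) = \<phi> (Tgt D f)"
    and comp: "\<And>g h. (g, h) \<in> composable D \<Longrightarrow> Comp C (b g, b h) = b (Comp D (g, h))"
    using iso by (auto simp: category_iso_def bij_betw_def)
  have composable: "(g, h) \<in> composable D \<longleftrightarrow> (b g, b h) \<in> composable C" if "g \<in> Mor D" "h \<in> Mor D" for g h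
  proof -
    have "b g \<in> Mor C" "b h \<in> Mor C" using that b(2) by blast+
    then show ?thesis
      using that st inj_on_eq_iff[OF \<phi> D.Src_in D.Tgt_in] by (simp add: composable_def)
  qed
  have Comp: "Comp C (b g, b h) = b f \<longleftrightarrow> Comp D (g, h) = f" if "(g, h) \<in> composable D" for g h
    unfolding comp[OF that] by (rule inj_on_eq_iff[OF b(1) D.Comp_in[OF that] f])
  have "(g, h) \<in> decompositions D f \<longleftrightarrow>
      g \<in> Mor D \<and> h \<in> Mor D \<and> (b g, b h) \<in> decompositions C (b f)" for g h
    unfolding decompositions_def mem_Collect_eq prod.case
    using composable Comp D.composableD by blast
  then show ?thesis by auto
qed

lemma category_iso_Obj:
  assumes C: "C \<in> labelled_categories n" and iso: "category_iso C D \<phi> b"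
  shows "Obj C = {i \<in> {1..n}. b i \<in> Id D ` Obj D}"
proof -
  have C': "Mor C = {1..n}" "Obj C \<subseteq> {1..n}" "\<And>x. x \<in> Obj C \<Longrightarrow> Id C x = x"
    using C by (auto simp: labelled_categories_def)
  have iso': "\<phi> ` Obj C = Obj D" "inj_on b {1..n}" "\<And>x. x \<in> Obj C \<Longrightarrow> Id D (\<phi> x) = b x"
    using iso C' by (auto simp: category_iso_def bij_betw_def)
  have "Id D ` Obj D = b ` Obj C"
    unfolding iso'(1)[symmetric] image_image by (rule image_cong[OF refl iso'(3)])
  moreover have "i \<in> Obj C \<longleftrightarrow> b i \<in> b ` Obj C" if "i \<in> {1..n}" for i
    using inj_on_image_mem_iff[OF iso'(2) that C'(2)] by blast
  ultimately show ?thesis using C'(2) by blast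
qed

lemma category_iso_unique:
  assumes "finite_category (C :: ('o, 'm) category)" "D \<in> labelled_categories n" "D' \<in> labelled_categories n"
    and iso: "category_iso D C \<phi> b" "category_iso D' C \<phi>' b"
  shows "D = D'"
proof (rule labelled_category_eqI)
  show "Obj D = Obj D'"
    unfolding category_iso_Obj[OF assms(2) iso(1)] category_iso_Obj[OF assms(3) iso(2)] ..
  fix f assume f: "f \<in> {1..n}"
  have Mor: "Mor D = {1..n}" "Mor D' = {1..n}"
    using assms(2,3) by (simp_all add: labelled_categories_def)
  show "decompositions D f = decompositions D' f"
    using category_iso_decompositions[OF assms(1) finite_category_labelled[OF assms(2)] iso(1), of f]
      category_iso_decompositions[OF assms(1) finite_category_labelled[OF assms(3)] iso(2), of f] f
    unfolding Mor by blast
qed (fact assms(2,3))+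

text \<open>
  The structure of \<open>C\<close> pulled back along a bijection \<open>b\<close> from \<open>I\<close> to
  its morphisms. An object is replaced by the label of its identity morphism.
\<close>

definition relabel :: "'l set \<Rightarrow> ('l \<Rightarrow> 'm) \<Rightarrow> ('o, 'm) category \<Rightarrow> ('l, 'l) category" where
  "relabel I b C =
     (let l = inv_into I b;
          K = {(g, h). g \<in> I \<and> h \<in> I \<and> (b g, b h) \<in> composable C}
      in \<lparr>Obj = {i \<in> I. b i \<in> Id C ` Obj C}, Mor = I,
          Src = (\<lambda>f\<in>I. l (Id C (Src C (b f)))), Tgt = (\<lambda>f\<in>I. l (Id C (Tgt C (b f)))),
          Id = (\<lambda>x\<in>{i \<in> I. b i \<in> Id C ` Obj C}. x),
          Comp = (\<lambda>(g, h)\<in>K. l (Comp C (b g, b h)))\<rparr>)"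

lemma relabel_simps:
  "Obj (relabel I b C) = {i \<in> I. b i \<in> Id C ` Obj C}" "Mor (relabel I b C) = I"
  "f \<in> I \<Longrightarrow> Src (relabel I b C) f = inv_into I b (Id C (Src C (b f)))"
  "f \<in> I \<Longrightarrow> Tgt (relabel I b C) f = inv_into I b (Id C (Tgt C (b f)))"
  "i \<in> Obj (relabel I b C) \<Longrightarrow> Id (relabel I b C) i = i"
  by (simp_all add: relabel_def Let_def)

text \<open>
  The object map sends a label \<open>i\<close> to the object whose identity is \<open>b i\<close>; its source
  is a way to name that object.
\<close>

lemma category_iso_relabel:
  assumes "finite_category (C :: ('o, 'm) category)" and b: "bij_betw b I (Mor C)"
  shows "small_category (relabel I b C)"
    and "category_iso (relabel I b C) C (\<lambda>i. Src C (b i)) b"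
proof -
  interpret C: finite_category C by fact
  let ?D = "relabel I b C" and ?l = "inv_into I b"
  have b_in: "b i \<in> Mor C" if "i \<in> I" for i using b that by (auto simp: bij_betw_def)
  have l_in: "?l f \<in> I" and b_l: "b (?l f) = f" if "f \<in> Mor C" for f
    using b that inv_into_into[of f b I] f_inv_into_f[of f b I] by (simp_all add: bij_betw_def)
  have l_b: "?l (b i) = i" if "i \<in> I" for i
    using b that by (simp add: bij_betw_def)
  note D = relabel_simps[where I = I and b = b and C = C]
  have l_Id_inj: "?l (Id C x) = ?l (Id C y) \<longleftrightarrow> x = y" if "x \<in> Obj C" "y \<in> Obj C" for x y
    using that C.Id_in b_l C.Src_Id by metis
  have composable: "(g, h) \<in> composable ?D \<longleftrightarrow> g \<in> I \<and> h \<in> I \<and> (b g, b h) \<in> composable C" for g h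
    using l_Id_inj b_in C.Src_in C.Tgt_in by (auto simp: composable_def D)
  have Comp: "Comp ?D (g, h) = ?l (Comp C (b g, b h))" if "(g, h) \<in> composable ?D" for g h
    using that unfolding composable by (simp add: relabel_def Let_def)
  have b_Comp: "b (Comp ?D (g, h)) = Comp C (b g, b h)" "Comp ?D (g, h) \<in> I"
    if "(g, h) \<in> composable ?D" for g h
    using that Comp[OF that] b_l l_in C.Comp_in unfolding composable by auto
  have Obj: "x \<in> Obj ?D \<Longrightarrow> x \<in> I \<and> Src C (b x) \<in> Obj C \<and> Id C (Src C (b x)) = b x \<and> Tgt C (b x) = Src C (b x)" for x
    by (auto simp: D C.Src_Id C.Tgt_Id)
  have l_Obj: "?l (Id C x) \<in> Obj ?D" if "x \<in> Obj C" for x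
    using that l_in b_l C.Id_in by (auto simp: D)
  show "small_category ?D"
  proof
    show "Src ?D \<in> Mor ?D \<rightarrow>\<^sub>E Obj ?D"
      using l_Obj b_in C.Src_in by (auto simp: PiE_iff D) (auto simp: relabel_def Let_def)
    show "Tgt ?D \<in> Mor ?D \<rightarrow>\<^sub>E Obj ?D"
      using l_Obj b_in C.Tgt_in by (auto simp: PiE_iff D) (auto simp: relabel_def Let_def)
    show "Id ?D \<in> Obj ?D \<rightarrow>\<^sub>E Mor ?D"
      by (auto simp: relabel_def Let_def)
    have "Comp ?D \<in> extensional {(g, h). g \<in> I \<and> h \<in> I \<and> (b g, b h) \<in> composable C}"
      unfolding relabel_def Let_def category.simps by (rule restrict_extensional)
    also have "{(g, h). g \<in> I \<and> h \<in> I \<and> (b g, b h) \<in> composable C} = composable ?D"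
      using composable by auto
    finally show "Comp ?D \<in> composable ?D \<rightarrow>\<^sub>E Mor ?D"
      using b_Comp by (auto simp: PiE_iff D)
    show "Src ?D (Id ?D x) = x" "Tgt ?D (Id ?D x) = x" if "x \<in> Obj ?D" for x
      using Obj[OF that] that by (simp_all add: D l_b)
    show "Src ?D (Comp ?D (g, h)) = Src ?D h" "Tgt ?D (Comp ?D (g, h)) = Tgt ?D g"
      if "(g, h) \<in> composable ?D" for g h
      using that b_Comp[OF that] by (simp_all add: D composable C.Src_Comp C.Tgt_Comp)
    show "Comp ?D (Id ?D (Tgt ?D f), f) = f" if "f \<in> Mor ?D" for f
    proof -
      have f: "f \<in> I" using that by (simp add: D)
      then have t: "Tgt C (b f) \<in> Obj C" using C.Tgt_in b_in by blast
      have "(?l (Id C (Tgt C (b f))), f) \<in> composable ?D"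
        using t f b_in C.Id_in l_in b_l C.composable_Id_left[OF t] by (simp add: composable)
      from Comp[OF this] show ?thesis
        using t f b_in C.Id_in b_l l_Obj by (simp add: D C.Comp_Id_left l_b)
    qed
    show "Comp ?D (f, Id ?D (Src ?D f)) = f" if "f \<in> Mor ?D" for f
    proof -
      have f: "f \<in> I" using that by (simp add: D)
      then have t: "Src C (b f) \<in> Obj C" using C.Src_in b_in by blast
      have "(f, ?l (Id C (Src C (b f)))) \<in> composable ?D"
        using t f b_in C.Id_in l_in b_l C.composable_Id_right[OF t] by (simp add: composable)
      from Comp[OF this] show ?thesis
        using t f b_in C.Id_in b_l l_Obj by (simp add: D C.Comp_Id_right l_b)
    qed
    show "Comp ?D (Comp ?D (f, g), h) = Comp ?D (f, Comp ?D (g, h))"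
      if fg: "(f, g) \<in> composable ?D" and gh: "(g, h) \<in> composable ?D" for f g h
    proof -
      have "(Comp ?D (f, g), h) \<in> composable ?D" "(f, Comp ?D (g, h)) \<in> composable ?D"
        using fg gh b_Comp[OF fg] b_Comp[OF gh]
        by (auto simp: composable C.composable_Comp_left C.composable_Comp_right)
      then show ?thesis
        using fg gh b_Comp[OF fg] b_Comp[OF gh] by (simp add: Comp[of "Comp ?D (f, g)"] Comp[of f "Comp ?D (g, h)"]
            composable C.Comp_assoc)
    qed
  qed
  show "category_iso ?D C (\<lambda>i. Src C (b i)) b"
    unfolding category_iso_def
  proof (intro conjI ballI)
    show "bij_betw (\<lambda>i. Src C (b i)) (Obj ?D) (Obj C)"
      by (rule bij_betw_byWitness[where f' = "\<lambda>x. ?l (Id C x)"])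
         (use Obj l_Obj l_b b_l C.Id_in C.Src_Id in auto)
    show "bij_betw b (Mor ?D) (Mor C)" using b by (simp add: D)
    show "Src C (b f) = Src C (b (Src ?D f))" "Tgt C (b f) = Src C (b (Tgt ?D f))" if "f \<in> Mor ?D" for f
      using that b_in b_l C.Id_in C.Src_in C.Tgt_in C.Src_Id by (simp_all add: D)
    show "Id C (Src C (b x)) = b (Id ?D x)" if "x \<in> Obj ?D" for x
      using Obj[OF that] that by (simp add: D)
    show "case p of (g, h) \<Rightarrow> Comp C (b g, b h) = b (Comp ?D (g, h))" if "p \<in> composable ?D" for p
      using that b_Comp by (cases p) simp
  qed
qed

lemma relabel_labelled:
  assumes "finite_category C" and "bij_betw b {1..n} (Mor C)"
  shows "relabel {1..n} b C \<in> labelled_categories n"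
  unfolding labelled_categories_def mem_Collect_eq
proof (intro conjI ballI)
  show "small_category (relabel {1..n} b C)" by (rule category_iso_relabel(1)[OF assms])
qed (auto simp only: relabel_simps)

section \<open>Weak bialgebra structures and finite categories\<close>

theorem theorem4p6:
  fixes n :: nat
  shows
    "(\<exists>\<Phi> :: ((nat \<Rightarrow> 'k::field) \<Rightarrow> (nat \<times> nat \<Rightarrow> 'k)) \<times> ((nat \<Rightarrow> 'k) \<Rightarrow> 'k) \<Rightarrow> (nat, nat) category.
        bij_betw \<Phi> (pointwise_wbs n) (labelled_categories n)
        \<and> (\<forall>(\<Delta>, \<epsilon>)\<in>pointwise_wbs n.
             card (Obj (\<Phi> (\<Delta>, \<epsilon>))) = card {i \<in> {1..n}. \<epsilon> (basis_vec i) = 1}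
             \<and> card (Mor (\<Phi> (\<Delta>, \<epsilon>))) = n
             \<and> Obj (\<Phi> (\<Delta>, \<epsilon>)) = {i \<in> {1..n}. \<epsilon> (basis_vec i) = 1}
             \<and> (\<forall>f\<in>{1..n}. \<Delta> (basis_vec f) =
                  (\<lambda>p. \<Sum>(g, h)\<in>decompositions (\<Phi> (\<Delta>, \<epsilon>)) f. tens (basis_vec g) (basis_vec h) p)))
        \<and> (\<forall>C\<in>labelled_categories n.
             (restrict (coprod C) (vecs {1..n}), restrict (counit C) (vecs {1..n})) \<in> pointwise_wbs n
             \<and> \<Phi> (restrict (coprod C) (vecs {1..n}), restrict (counit C) (vecs {1..n})) = C)
        \<and> (\<forall>(C :: ('o, 'm) category) b. small_category C \<and> bij_betw b {1..n} (Mor C) \<longrightarrow>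
             (\<exists>!S. S \<in> pointwise_wbs n \<and> (\<exists>\<phi>. category_iso (\<Phi> S) C \<phi> b))))
     \<and> (\<forall>C :: ('o, 'm) category. small_category C \<and> finite (Mor C) \<and> card (Mor C) = n \<longrightarrow>
          weak_bialgebra_on (Mor C) pointwise_mult (pointwise_unit (Mor C))
            (coprod C :: ('m \<Rightarrow> 'k) \<Rightarrow> _) (counit C)
          \<and> weak_bialgebra_on (Mor C) (comp_mult C) (comp_unit C)
            (diag_coprod C :: ('m \<Rightarrow> 'k) \<Rightarrow> _) (diag_counit C)
          \<and> (\<forall>f\<in>Mor C. \<forall>g\<in>Mor C. \<forall>h\<in>Mor C.
                coprod C (basis_vec f :: 'm \<Rightarrow> 'k) (g, h) = comp_mult C (basis_vec g) (basis_vec h) f)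
          \<and> (\<forall>f\<in>Mor C. counit C (basis_vec f :: 'm \<Rightarrow> 'k) = comp_unit C f))"
proof (rule conjI)
  let ?L = "labelled_categories n"
  let ?\<Psi> = "category_wbs n :: _ \<Rightarrow> ((nat \<Rightarrow> 'k) \<Rightarrow> (nat \<times> nat \<Rightarrow> 'k)) \<times> ((nat \<Rightarrow> 'k) \<Rightarrow> 'k)"
  \<comment> \<open>The category of a structure is obtained by inverting the map from categories to structures.\<close>
  let ?\<Phi> = "inv_into ?L ?\<Psi>"
  have bij: "bij_betw ?\<Psi> ?L (pointwise_wbs n)" by (rule bij_betw_category_wbs)
  then have \<Phi>_in: "?\<Phi> S \<in> ?L" and \<Psi>\<Phi>: "?\<Psi> (?\<Phi> S) = S" if "S \<in> pointwise_wbs n" for S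
    using that by (auto simp: bij_betw_def intro: inv_into_into f_inv_into_f)
  have \<Phi>\<Psi>: "?\<Phi> (?\<Psi> C) = C" if "C \<in> ?L" for C
    using bij that by (simp add: bij_betw_def)
  have spec: "card (Obj (?\<Phi> (\<Delta>, \<epsilon>))) = card {i \<in> {1..n}. \<epsilon> (basis_vec i) = 1}
      \<and> card (Mor (?\<Phi> (\<Delta>, \<epsilon>))) = n
      \<and> Obj (?\<Phi> (\<Delta>, \<epsilon>)) = {i \<in> {1..n}. \<epsilon> (basis_vec i) = 1}
      \<and> (\<forall>f\<in>{1..n}. \<Delta> (basis_vec f) =
           (\<lambda>p. \<Sum>(g, h)\<in>decompositions (?\<Phi> (\<Delta>, \<epsilon>)) f. tens (basis_vec g) (basis_vec h) p))"
    if S: "(\<Delta>, \<epsilon>) \<in> pointwise_wbs n" for \<Delta> \<epsilon>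
  proof -
    let ?C = "?\<Phi> (\<Delta>, \<epsilon>)"
    interpret C: finite_category ?C by (rule finite_category_labelled[OF \<Phi>_in[OF S]])
    have C: "Mor ?C = {1..n}" "Obj ?C \<subseteq> {1..n}" "Id ?C ` Obj ?C = Obj ?C"
      using \<Phi>_in[OF S] by (auto simp: labelled_categories_def)
    have eqs: "\<Delta> = restrict (coprod ?C) (vecs {1..n})" "\<epsilon> = restrict (counit ?C) (vecs {1..n})"
      using \<Psi>\<Phi>[OF S] by (simp_all add: category_wbs_def)
    have "\<epsilon> (basis_vec i) = of_bool (i \<in> Obj ?C)" if "i \<in> {1..n}" for i
      by (subst eqs(2)) (use that C C.counit_basis_vec[of i, where 'k = 'k] in simp)
    then have obj: "Obj ?C = {i \<in> {1..n}. \<epsilon> (basis_vec i) = 1}"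
      using C(2) by auto
    have "\<Delta> (basis_vec f) = (\<lambda>p. \<Sum>(g, h)\<in>decompositions ?C f. tens (basis_vec g) (basis_vec h) p)"
      if "f \<in> {1..n}" for f
    proof -
      have "\<Delta> (basis_vec f) = coprod ?C (basis_vec f)"
        by (subst eqs(1)) (use that in simp)
      also have "\<dots> = (\<lambda>p. \<Sum>(g, h)\<in>decompositions ?C f. tens (basis_vec g) (basis_vec h) p)"
        using that unfolding coprod_def basis_vec_apply C(1) by (simp only: sum_of_bool_eq finite_atLeastAtMost if_True)
      finally show ?thesis .
    qed
    then show ?thesis using obj C(1) by simp
  qed
  have transport: "\<exists>!S. S \<in> pointwise_wbs n \<and> (\<exists>\<phi>. category_iso (?\<Phi> S) C \<phi> b)"
    if C: "small_category C" and b: "bij_betw b {1..n} (Mor C)" for C :: "('o, 'm) category" and b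
  proof -
    have fin: "finite_category C"
      using C b bij_betw_finite by (auto simp: finite_category_def finite_category_axioms_def)
    show ?thesis
    proof (rule ex1I)
      show "?\<Psi> (relabel {1..n} b C) \<in> pointwise_wbs n \<and> (\<exists>\<phi>. category_iso (?\<Phi> (?\<Psi> (relabel {1..n} b C))) C \<phi> b)"
        using relabel_labelled[OF fin b] category_iso_relabel(2)[OF fin b] by (auto simp only: category_wbs_in \<Phi>\<Psi>)
      fix S assume S: "S \<in> pointwise_wbs n \<and> (\<exists>\<phi>. category_iso (?\<Phi> S) C \<phi> b)"
      then have "?\<Phi> S = relabel {1..n} b C"
        using category_iso_unique[OF fin \<Phi>_in relabel_labelled[OF fin b] _ category_iso_relabel(2)[OF fin b]] by blast
      then show "S = ?\<Psi> (relabel {1..n} b C)" using \<Psi>\<Phi> S by metis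
    qed
  qed
  show "\<exists>\<Phi> :: ((nat \<Rightarrow> 'k::field) \<Rightarrow> (nat \<times> nat \<Rightarrow> 'k)) \<times> ((nat \<Rightarrow> 'k) \<Rightarrow> 'k) \<Rightarrow> (nat, nat) category.
        bij_betw \<Phi> (pointwise_wbs n) (labelled_categories n)
        \<and> (\<forall>(\<Delta>, \<epsilon>)\<in>pointwise_wbs n.
             card (Obj (\<Phi> (\<Delta>, \<epsilon>))) = card {i \<in> {1..n}. \<epsilon> (basis_vec i) = 1}
             \<and> card (Mor (\<Phi> (\<Delta>, \<epsilon>))) = n
             \<and> Obj (\<Phi> (\<Delta>, \<epsilon>)) = {i \<in> {1..n}. \<epsilon> (basis_vec i) = 1}
             \<and> (\<forall>f\<in>{1..n}. \<Delta> (basis_vec f) =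
                  (\<lambda>p. \<Sum>(g, h)\<in>decompositions (\<Phi> (\<Delta>, \<epsilon>)) f. tens (basis_vec g) (basis_vec h) p)))
        \<and> (\<forall>C\<in>labelled_categories n.
             (restrict (coprod C) (vecs {1..n}), restrict (counit C) (vecs {1..n})) \<in> pointwise_wbs n
             \<and> \<Phi> (restrict (coprod C) (vecs {1..n}), restrict (counit C) (vecs {1..n})) = C)
        \<and> (\<forall>(C :: ('o, 'm) category) b. small_category C \<and> bij_betw b {1..n} (Mor C) \<longrightarrow>
             (\<exists>!S. S \<in> pointwise_wbs n \<and> (\<exists>\<phi>. category_iso (\<Phi> S) C \<phi> b)))"
  proof (rule exI[of _ ?\<Phi>], intro conjI)
    show "bij_betw ?\<Phi> (pointwise_wbs n) ?L" by (rule bij_betw_inv_into[OF bij])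
  qed (use spec transport category_wbs_in \<Phi>\<Psi> in \<open>auto simp: category_wbs_def\<close>)
next
  show "\<forall>C :: ('o, 'm) category. small_category C \<and> finite (Mor C) \<and> card (Mor C) = n \<longrightarrow>
          weak_bialgebra_on (Mor C) pointwise_mult (pointwise_unit (Mor C))
            (coprod C :: ('m \<Rightarrow> 'k) \<Rightarrow> _) (counit C)
          \<and> weak_bialgebra_on (Mor C) (comp_mult C) (comp_unit C)
            (diag_coprod C :: ('m \<Rightarrow> 'k) \<Rightarrow> _) (diag_counit C)
          \<and> (\<forall>f\<in>Mor C. \<forall>g\<in>Mor C. \<forall>h\<in>Mor C.
                coprod C (basis_vec f :: 'm \<Rightarrow> 'k) (g, h) = comp_mult C (basis_vec g) (basis_vec h) f)
          \<and> (\<forall>f\<in>Mor C. counit C (basis_vec f :: 'm \<Rightarrow> 'k) = comp_unit C f)"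
  proof (intro allI impI)
    fix C :: "('o, 'm) category"
    assume "small_category C \<and> finite (Mor C) \<and> card (Mor C) = n"
    then interpret finite_category C
      by (simp add: finite_category_def finite_category_axioms_def)
    show "weak_bialgebra_on (Mor C) pointwise_mult (pointwise_unit (Mor C))
            (coprod C :: ('m \<Rightarrow> 'k) \<Rightarrow> _) (counit C)
          \<and> weak_bialgebra_on (Mor C) (comp_mult C) (comp_unit C)
            (diag_coprod C :: ('m \<Rightarrow> 'k) \<Rightarrow> _) (diag_counit C)
          \<and> (\<forall>f\<in>Mor C. \<forall>g\<in>Mor C. \<forall>h\<in>Mor C.
                coprod C (basis_vec f :: 'm \<Rightarrow> 'k) (g, h) = comp_mult C (basis_vec g) (basis_vec h) f)
          \<and> (\<forall>f\<in>Mor C. counit C (basis_vec f :: 'm \<Rightarrow> 'k) = comp_unit C f)"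
      using coprod_weak_bialgebra category_algebra_weak_bialgebra
      by (auto simp: coprod_apply comp_mult_basis_vec comp_coeff_def basis_vec_apply
          counit_basis_vec comp_unit_apply)
  qed
qed

end
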